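(* Let $s\ge2$ be an integer and let $\lambda_s=\frac{\Gamma(1/s)^s}{s^s\, s!}$. Let $B$ be a fixed (deterministic) sequence of nonnegative integers with counting function $B(n)=|\{b\in B: b\le n\}|$ satisfying $$\liminf_{n\to\infty}\frac{B(n)}{\log n}<\lambda_s^{-1}.$$ Let $A$ be a random sequence of pseudo $s$-th powers. Then, almost surely, there are infinitely many integers $n$ that cannot be written in the form $$n=a_1+\cdots+a_s+b,\qquad \text{with pairwise distinct } a_1,\dots,a_s\in A \text{ and } b\in B.$$
   Context: A random sequence of pseudo $s$-th powers is defined as follows: on a probability space one takes independent Bernoulli random variables $(\xi_n)_{n\ge1}$ with $\mathbb P(\xi_n=1)=\frac1s n^{-1+1/s}$, and sets $A=\{n\ge1:\xi_n=1\}$. Thus the events $\{n\in A\}$ are independent and $\mathbb P(n\in A)=\frac1s n^{-1+1/s}$. *)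

theory Defs
  imports "HOL-Probability.Probability"
begin

definition lambda_const :: "nat \<Rightarrow> real" where
  "lambda_const s = Gamma (1 / real s) ^ s / (real s ^ s * fact s)"

definition counting_fun :: "nat set \<Rightarrow> nat \<Rightarrow> nat" where
  "counting_fun B n = card {b \<in> B. b \<le> n}"

text \<open>
  The values True and False of the Bernoulli variables play the roles of 1 and 0.
  For \<open>s \<ge> 2\<close> and \<open>n \<ge> 1\<close> the parameter lies in \<open>[0, 1]\<close>, so the
  clamping built into \<^const>\<open>bernoulli_pmf\<close> has no effect.
\<close>

definition (in prob_space) pseudo_power_vars :: "nat \<Rightarrow> (nat \<Rightarrow> 'a \<Rightarrow> bool) \<Rightarrow> bool" where
  "pseudo_power_vars s \<xi> \<longleftrightarrow>
     indep_vars (\<lambda>_. count_space UNIV) \<xi> {1..} \<and>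
     (\<forall>n\<ge>1. distr M (count_space UNIV) (\<xi> n) =
        measure_pmf (bernoulli_pmf (1 / real s * real n powr (- 1 + 1 / real s))))"

definition pseudo_powers :: "(nat \<Rightarrow> 'a \<Rightarrow> bool) \<Rightarrow> 'a \<Rightarrow> nat set" where
  "pseudo_powers \<xi> \<omega> = {n. n \<ge> 1 \<and> \<xi> n \<omega>}"

definition representable :: "nat \<Rightarrow> nat set \<Rightarrow> nat set \<Rightarrow> nat \<Rightarrow> bool" where
  "representable s A B n \<longleftrightarrow>
     (\<exists>a b. (\<forall>i\<in>{1..s}. a i \<in> A) \<and> inj_on a {1..s} \<and> b \<in> B \<and> n = (\<Sum>i=1..s. a i) + b)"

end

theory Submission
  imports Defs "HOL-Real_Asymp.Real_Asymp"
begin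

text \<open>
  Let \<open>c < 1 / \<lambda>\<close> and let \<open>N\<close> be one of the infinitely many integers with \<open>B(N) \<le> c ln N\<close>. An
  integer \<open>n \<le> N\<close> is not representable iff no \<open>s\<close>-subset of \<open>A\<close> has its sum in \<open>n - B\<close>. The
  expected number of such subsets is at most \<open>\<lambda> B(N) \<le> c \<lambda> ln N\<close>, so by the Harris inequality
  \<open>n\<close> fails to be representable with probability at least about \<open>N powr (- c \<lambda>)\<close>, and the expected
  number of failures up to \<open>N\<close> tends to infinity. Janson's inequality, applied to two shifted sets
  \<open>n - B\<close> and \<open>m - B\<close> that are disjoint and avoid small integers, shows that the two failures are
  asymptotically independent; only \<open>B(N)\<^sup>2\<close> many \<open>m\<close> are excluded for each \<open>n\<close>, and only few \<open>n\<close>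
  have small elements in \<open>n - B\<close>. By Chebyshev's inequality the probability that all \<open>n\<close> in
  \<open>(N\<^sub>0, N]\<close> are representable tends to \<open>0\<close> along these \<open>N\<close>.
\<close>

section \<open>Random subsets of a finite set\<close>

definition random_subset :: "'i set \<Rightarrow> ('i \<Rightarrow> real) \<Rightarrow> 'i set pmf" where
  "random_subset I p = map_pmf (\<lambda>\<omega>. {i\<in>I. \<omega> i}) (Pi_pmf I False (\<lambda>i. bernoulli_pmf (p i)))"

abbreviation subset_prob :: "'i set \<Rightarrow> ('i \<Rightarrow> real) \<Rightarrow> ('i set \<Rightarrow> bool) \<Rightarrow> real" where
  "subset_prob I p P \<equiv> measure_pmf.prob (random_subset I p) (Collect P)"

lemma random_subset_empty [simp]: "random_subset {} p = return_pmf {}"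
  by (simp add: random_subset_def)

lemma random_subset_insert:
  assumes "finite I" "i \<notin> I"
  shows "random_subset (insert i I) p =
    bind_pmf (bernoulli_pmf (p i))
      (\<lambda>b. map_pmf (\<lambda>A. if b then insert i A else A) (random_subset I p))"
proof -
  have "{j\<in>insert i I. fun_upd \<omega> i b j} = (if b then insert i {j\<in>I. \<omega> j} else {j\<in>I. \<omega> j})" for b \<omega>
    using assms(2) by auto
  then show ?thesis
    using assms
    by (simp add: random_subset_def Pi_pmf_insert' map_pmf_def bind_assoc_pmf bind_return_pmf)
qed

lemma subset_prob_insert:
  assumes "finite I" "i \<notin> I"
  shows "subset_prob (insert i I) p P =
    (1 - pmf (bernoulli_pmf (p i)) True) * subset_prob I p P +
    pmf (bernoulli_pmf (p i)) True * subset_prob I p (\<lambda>A. P (insert i A))"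
proof -
  have pmf_eq: "subset_prob J p Q = pmf (map_pmf Q (random_subset J p)) True"
    for J :: "'a set" and Q
    by (simp add: pmf_map vimage_def)
  have "subset_prob (insert i I) p P = pmf (bind_pmf (bernoulli_pmf (p i))
      (\<lambda>b. map_pmf (\<lambda>A. P (if b then insert i A else A)) (random_subset I p))) True"
    unfolding pmf_eq
    by (simp only: random_subset_insert[OF assms] map_bind_pmf pmf.map_comp o_def)
  also have "\<dots> = (\<Sum>b\<in>UNIV. subset_prob I p (\<lambda>A. P (if b then insert i A else A)) *
      pmf (bernoulli_pmf (p i)) b)"
    unfolding pmf_bind pmf_eq by (rule integral_measure_pmf_real) auto
  finally show ?thesis
    by (simp add: UNIV_bool pmf_False_conv_True mult.commute)
qed

lemma set_pmf_random_subsetD: "finite I \<Longrightarrow> A \<in> set_pmf (random_subset I p) \<Longrightarrow> A \<subseteq> I"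
  by (auto simp: random_subset_def)

lemma subset_prob_cong:
  assumes "finite I" "\<And>A. A \<subseteq> I \<Longrightarrow> P A \<longleftrightarrow> Q A"
  shows "subset_prob I p P = subset_prob I p Q"
proof -
  have "Collect P \<inter> set_pmf (random_subset I p) = Collect Q \<inter> set_pmf (random_subset I p)"
    using assms set_pmf_random_subsetD by blast
  then show ?thesis
    using measure_Int_set_pmf by metis
qed

lemma pmf_random_subset:
  assumes "finite I" "S \<subseteq> I"
  shows "pmf (random_subset I p) S = (\<Prod>i\<in>I. pmf (bernoulli_pmf (p i)) (i \<in> S))"
proof -
  let ?R = "Pi_pmf I False (\<lambda>i. bernoulli_pmf (p i))"
  have "{i\<in>I. \<omega> i} = S \<longleftrightarrow> \<omega> = (\<lambda>i. i \<in> S)" if "\<omega> \<in> set_pmf ?R" for \<omega>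
    using that assms set_Pi_pmf_subset[OF assms(1)] by (fastforce simp: fun_eq_iff)
  then have "(\<lambda>\<omega>. {i\<in>I. \<omega> i}) -` {S} \<inter> set_pmf ?R = {\<lambda>i. i \<in> S} \<inter> set_pmf ?R"
    by blast
  then have "pmf (random_subset I p) S = pmf ?R (\<lambda>i. i \<in> S)"
    unfolding random_subset_def pmf_map by (metis measure_Int_set_pmf measure_pmf_single)
  also have "\<dots> = (\<Prod>i\<in>I. pmf (bernoulli_pmf (p i)) (i \<in> S))"
    using assms by (intro pmf_Pi') auto
  finally show ?thesis .
qed

lemma subset_prob_superset:
  assumes "finite I" "S \<subseteq> I" "\<And>i. i \<in> S \<Longrightarrow> p i \<in> {0..1}"
  shows "subset_prob I p (\<lambda>A. S \<subseteq> A) = prod p S"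
proof -
  have "(\<lambda>\<omega>. {i\<in>I. \<omega> i}) -` {A. S \<subseteq> A} = Pi I (\<lambda>i. {b. i \<in> S \<longrightarrow> b})"
    using assms(2) by (auto simp: Pi_iff)
  then have "subset_prob I p (\<lambda>A. S \<subseteq> A) =
      (\<Prod>i\<in>I. measure_pmf.prob (bernoulli_pmf (p i)) {b. i \<in> S \<longrightarrow> b})"
    by (simp add: random_subset_def measure_Pi_pmf_Pi assms(1))
  also have "\<dots> = (\<Prod>i\<in>S. p i)"
  proof (rule prod.mono_neutral_cong_right)
    fix i assume "i \<in> S"
    then have "{b. i \<in> S \<longrightarrow> b} = {True}" by auto
    then show "measure_pmf.prob (bernoulli_pmf (p i)) {b. i \<in> S \<longrightarrow> b} = p i"
      using assms(3)[OF \<open>i \<in> S\<close>] by (simp add: measure_pmf_single)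
  qed (use assms in auto)
  finally show ?thesis .
qed

lemma subset_prob_not: "subset_prob I p (\<lambda>A. \<not> P A) = 1 - subset_prob I p P"
  using measure_pmf.prob_compl[of "Collect P" "random_subset I p"]
  by (simp add: Collect_neg_eq Compl_eq_Diff_UNIV)

lemma subset_prob_conj_not:
  "subset_prob I p (\<lambda>A. P A \<and> \<not> Q A) = subset_prob I p P - subset_prob I p (\<lambda>A. P A \<and> Q A)"
proof -
  have "{A. P A \<and> \<not> Q A} = Collect P - {A. P A \<and> Q A}" by auto
  then show ?thesis
    by (simp add: measure_pmf.finite_measure_Diff Collect_mono)
qed

lemma harris_inequality:
  assumes "finite I" "mono P" "mono Q"
  shows "subset_prob I p P * subset_prob I p Q \<le> subset_prob I p (\<lambda>A. P A \<and> Q A)"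
  using assms
proof (induction I arbitrary: P Q rule: finite_induct)
  case empty
  then show ?case by (simp add: indicator_def)
next
  case (insert i I)
  define q where "q = pmf (bernoulli_pmf (p i)) True"
  define P' Q' where "P' = (\<lambda>A. P (insert i A))" and "Q' = (\<lambda>A. Q (insert i A))"
  define a b a' b' where "a = subset_prob I p P" and "b = subset_prob I p Q"
    and "a' = subset_prob I p P'" and "b' = subset_prob I p Q'"
  have q_bounds: "0 \<le> q" "q \<le> 1"
    by (simp_all add: q_def pmf_le_1)
  have mono': "mono P'" "mono Q'"
    unfolding P'_def Q'_def
    by (auto intro!: monoI monoD[OF insert.prems(1)] monoD[OF insert.prems(2)])
  have imp: "P A \<Longrightarrow> P' A" "Q A \<Longrightarrow> Q' A" for A
    using monoD[OF insert.prems(1), of A "insert i A"]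
      monoD[OF insert.prems(2), of A "insert i A"]
    by (auto simp: P'_def Q'_def)
  have "a \<le> a'" "b \<le> b'"
    using imp by (auto simp: a_def b_def a'_def b'_def intro!: measure_pmf.finite_measure_mono)
  then have "0 \<le> q * (1 - q) * ((a' - a) * (b' - b))"
    using q_bounds by (intro mult_nonneg_nonneg) auto
  then have "((1 - q) * a + q * a') * ((1 - q) * b + q * b') \<le> (1 - q) * (a * b) + q * (a' * b')"
    by (simp add: algebra_simps)
  also have "\<dots> \<le> (1 - q) * subset_prob I p (\<lambda>A. P A \<and> Q A) +
      q * subset_prob I p (\<lambda>A. P' A \<and> Q' A)"
    unfolding a_def b_def a'_def b'_def
    using insert.IH[OF insert.prems] insert.IH[OF mono'] q_bounds
    by (intro add_mono mult_left_mono) auto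
  finally show ?case
    unfolding subset_prob_insert[OF insert.hyps]
    by (simp add: q_def a_def b_def a'_def b'_def P'_def Q'_def)
qed

lemma harris_inequality_mono_antimono:
  assumes "finite I" "mono P" "antimono Q"
  shows "subset_prob I p (\<lambda>A. P A \<and> Q A) \<le> subset_prob I p P * subset_prob I p Q"
proof -
  have "mono (\<lambda>A. \<not> Q A)" using antimonoD[OF assms(3)] by (auto intro!: monoI)
  from harris_inequality[OF assms(1,2) this, of p] show ?thesis
    by (simp add: subset_prob_not subset_prob_conj_not right_diff_distrib)
qed

lemma harris_inequality_antimono:
  assumes "finite I" "antimono P" "antimono Q"
  shows "subset_prob I p P * subset_prob I p Q \<le> subset_prob I p (\<lambda>A. P A \<and> Q A)"
proof -
  have "mono (\<lambda>A. \<not> Q A)" using antimonoD[OF assms(3)] by (auto intro!: monoI)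
  from harris_inequality_mono_antimono[OF assms(1) this assms(2), of p] show ?thesis
    by (simp add: conj_commute subset_prob_not subset_prob_conj_not algebra_simps)
qed

definition depends_on :: "'i set \<Rightarrow> ('i set \<Rightarrow> bool) \<Rightarrow> bool" where
  "depends_on U P \<longleftrightarrow> (\<forall>A. P (A \<inter> U) \<longleftrightarrow> P A)"

lemma depends_on_insert:
  assumes "depends_on U P"
  shows "depends_on U (\<lambda>A. P (insert i A))"
proof -
  have "insert i (A \<inter> U) \<inter> U = insert i A \<inter> U" for A by auto
  then show ?thesis using assms unfolding depends_on_def by metis
qed

lemma depends_on_insert_eq:
  assumes "depends_on U P" "i \<notin> U"
  shows "(\<lambda>A. P (insert i A)) = P"
proof
  fix A
  have "insert i A \<inter> U = A \<inter> U" using assms(2) by auto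
  then show "P (insert i A) \<longleftrightarrow> P A" using assms(1) unfolding depends_on_def by metis
qed

lemma subset_prob_conj_disjoint:
  assumes "finite I" "depends_on U P" "depends_on W Q" "U \<inter> W = {}"
  shows "subset_prob I p (\<lambda>A. P A \<and> Q A) = subset_prob I p P * subset_prob I p Q"
  using assms
proof (induction I arbitrary: P Q rule: finite_induct)
  case empty
  then show ?case by (simp add: indicator_def)
next
  case (insert i I)
  have "i \<notin> U \<or> i \<notin> W" using insert.prems(3) by auto
  then have "(\<lambda>A. P (insert i A)) = P \<or> (\<lambda>A. Q (insert i A)) = Q"
    using depends_on_insert_eq insert.prems(1,2) by metis
  then show ?case
    unfolding subset_prob_insert[OF insert.hyps] insert.IH[OF insert.prems]
      insert.IH[OF depends_on_insert[OF insert.prems(1)] depends_on_insert[OF insert.prems(2)]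
        insert.prems(3)]
    by (elim disjE) (simp_all add: algebra_simps)
qed

section \<open>Avoiding a family of sets: the Harris and Janson bounds\<close>

definition avoids :: "'i set set \<Rightarrow> 'i set \<Rightarrow> bool" where
  "avoids \<T> A \<longleftrightarrow> (\<forall>S\<in>\<T>. \<not> S \<subseteq> A)"

lemma avoids_empty [simp]: "avoids {} A"
  by (simp add: avoids_def)

lemma avoids_insert: "avoids (insert S \<T>) A \<longleftrightarrow> \<not> S \<subseteq> A \<and> avoids \<T> A"
  by (simp add: avoids_def)

lemma avoids_Un: "avoids (\<S> \<union> \<T>) A \<longleftrightarrow> avoids \<S> A \<and> avoids \<T> A"
  by (auto simp: avoids_def)

lemma antimono_avoids: "antimono (avoids \<T>)"
  by (rule antimonoI) (auto simp: avoids_def)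

lemma depends_on_avoids: "(\<And>S. S \<in> \<T> \<Longrightarrow> S \<subseteq> U) \<Longrightarrow> depends_on U (avoids \<T>)"
  by (simp add: depends_on_def avoids_def)

lemma prod_le_subset_prob_avoids:
  assumes "finite I" "finite \<T>"
  shows "(\<Prod>S\<in>\<T>. 1 - subset_prob I p (\<lambda>A. S \<subseteq> A)) \<le> subset_prob I p (avoids \<T>)"
  using assms(2)
proof (induction \<T> rule: finite_induct)
  case empty
  then show ?case by (simp add: indicator_def)
next
  case (insert S \<T>)
  have "(\<Prod>S\<in>insert S \<T>. 1 - subset_prob I p (\<lambda>A. S \<subseteq> A)) \<le>
      subset_prob I p (\<lambda>A. \<not> S \<subseteq> A) * subset_prob I p (avoids \<T>)"
    using insert by (simp add: subset_prob_not mult_left_mono)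
  also have "\<dots> \<le> subset_prob I p (\<lambda>A. \<not> S \<subseteq> A \<and> avoids \<T> A)"
    using assms(1) by (intro harris_inequality_antimono antimono_avoids antimonoI) auto
  finally show ?case by (simp add: avoids_insert[abs_def])
qed

lemma exp_minus_le_one_minus:
  assumes "0 \<le> w" "w \<le> \<eta>" "\<eta> \<le> 1 / 2"
  shows "exp (- (1 + 2 * \<eta>) * w) \<le> (1 - w :: real)"
proof -
  have "w * w \<le> \<eta> * w" using assms by (intro mult_right_mono) auto
  then have "- (1 + 2 * \<eta>) * w \<le> - w - 2 * w\<^sup>2"
    by (simp add: algebra_simps power2_eq_square)
  also have "\<dots> \<le> ln (1 - w)"
    using assms by (intro ln_one_minus_pos_lower_bound) auto
  finally show ?thesis
    using assms by (subst ln_ge_iff[symmetric]) auto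
qed

lemma exp_le_subset_prob_avoids:
  assumes "finite I" "finite \<T>" "\<And>S. S \<in> \<T> \<Longrightarrow> subset_prob I p (\<lambda>A. S \<subseteq> A) \<le> \<eta>" "\<eta> \<le> 1 / 2"
  shows "exp (- (1 + 2 * \<eta>) * (\<Sum>S\<in>\<T>. subset_prob I p (\<lambda>A. S \<subseteq> A))) \<le> subset_prob I p (avoids \<T>)"
proof -
  have "exp (- (1 + 2 * \<eta>) * (\<Sum>S\<in>\<T>. subset_prob I p (\<lambda>A. S \<subseteq> A))) =
      (\<Prod>S\<in>\<T>. exp (- (1 + 2 * \<eta>) * subset_prob I p (\<lambda>A. S \<subseteq> A)))"
    unfolding sum_distrib_left by (rule exp_sum[OF assms(2)])
  also have "\<dots> \<le> (\<Prod>S\<in>\<T>. 1 - subset_prob I p (\<lambda>A. S \<subseteq> A))"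
    using assms(3,4) by (intro prod_mono conjI exp_minus_le_one_minus) auto
  also have "\<dots> \<le> subset_prob I p (avoids \<T>)"
    using assms(1,2) by (rule prod_le_subset_prob_avoids)
  finally show ?thesis .
qed

text \<open>
  Only the members of \<open>\<T>\<close> that meet \<open>S\<close> correlate with \<open>S \<subseteq> A\<close>: the others are avoided
  independently of it, and a union bound takes care of the former.
\<close>

lemma subset_prob_superset_avoids_ge:
  fixes S :: "'i set"
  assumes "finite I" "finite \<T>"
  defines "D \<equiv> {T\<in>\<T>. S \<inter> T \<noteq> {}}"
  shows "(subset_prob I p (\<lambda>A. S \<subseteq> A) - (\<Sum>T\<in>D. subset_prob I p (\<lambda>A. S \<union> T \<subseteq> A))) *
      subset_prob I p (avoids (\<T> - D)) \<le> subset_prob I p (\<lambda>A. S \<subseteq> A \<and> avoids \<T> A)"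
proof -
  let ?P = "subset_prob I p" and ?\<F> = "\<T> - D"
  have "finite D" using assms(2) by (simp add: D_def)
  have indep: "?P (\<lambda>A. S \<subseteq> A \<and> avoids ?\<F> A) = ?P (\<lambda>A. S \<subseteq> A) * ?P (avoids ?\<F>)"
  proof (rule subset_prob_conj_disjoint[OF assms(1)])
    show "depends_on S (\<lambda>A. S \<subseteq> A)" by (auto simp: depends_on_def)
    show "depends_on (- S) (avoids ?\<F>)" by (rule depends_on_avoids) (auto simp: D_def)
  qed simp
  have harris: "?P (\<lambda>A. S \<union> T \<subseteq> A \<and> avoids ?\<F> A) \<le> ?P (\<lambda>A. S \<union> T \<subseteq> A) * ?P (avoids ?\<F>)" for T
    using assms(1) by (intro harris_inequality_mono_antimono antimono_avoids monoI) auto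
  have "{A. S \<subseteq> A \<and> avoids ?\<F> A} \<subseteq>
      {A. S \<subseteq> A \<and> avoids \<T> A} \<union> (\<Union>T\<in>D. {A. S \<union> T \<subseteq> A \<and> avoids ?\<F> A})"
    by (auto simp: avoids_def)
  then have "?P (\<lambda>A. S \<subseteq> A \<and> avoids ?\<F> A) \<le>
      measure_pmf.prob (random_subset I p)
        ({A. S \<subseteq> A \<and> avoids \<T> A} \<union> (\<Union>T\<in>D. {A. S \<union> T \<subseteq> A \<and> avoids ?\<F> A}))"
    by (intro measure_pmf.finite_measure_mono) auto
  also have "\<dots> \<le> ?P (\<lambda>A. S \<subseteq> A \<and> avoids \<T> A) + (\<Sum>T\<in>D. ?P (\<lambda>A. S \<union> T \<subseteq> A \<and> avoids ?\<F> A))"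
    using \<open>finite D\<close>
    by (intro order.trans[OF measure_Un_le] add_left_mono measure_UNION_le) auto
  also have "\<dots> \<le> ?P (\<lambda>A. S \<subseteq> A \<and> avoids \<T> A) + (\<Sum>T\<in>D. ?P (\<lambda>A. S \<union> T \<subseteq> A) * ?P (avoids ?\<F>))"
    by (intro add_left_mono sum_mono harris)
  finally show ?thesis
    by (simp add: indep left_diff_distrib sum_distrib_right)
qed

lemma subset_prob_avoids_insert_le:
  assumes "finite I" "finite \<T>"
  shows "subset_prob I p (avoids (insert S \<T>)) \<le>
    exp (- subset_prob I p (\<lambda>A. S \<subseteq> A) +
      (\<Sum>T\<in>{T\<in>\<T>. S \<inter> T \<noteq> {}}. subset_prob I p (\<lambda>A. S \<union> T \<subseteq> A))) *
    subset_prob I p (avoids \<T>)"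
proof -
  let ?P = "subset_prob I p" and ?D = "{T\<in>\<T>. S \<inter> T \<noteq> {}}"
  define q where "q = ?P (\<lambda>A. S \<subseteq> A) - (\<Sum>T\<in>?D. ?P (\<lambda>A. S \<union> T \<subseteq> A))"
  have "q * ?P (avoids \<T>) \<le> ?P (\<lambda>A. S \<subseteq> A \<and> avoids \<T> A)"
  proof (cases "0 \<le> q")
    case True
    have "?P (avoids \<T>) \<le> ?P (avoids (\<T> - ?D))"
      by (intro measure_pmf.finite_measure_mono) (auto simp: avoids_def)
    from mult_left_mono[OF this True] show ?thesis
      using subset_prob_superset_avoids_ge[OF assms, where S = S and p = p] by (simp add: q_def)
  next
    case False
    then have "q * ?P (avoids \<T>) \<le> 0" by (simp add: mult_nonpos_nonneg)
    then show ?thesis using measure_nonneg by (rule order.trans)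
  qed
  moreover have "?P (avoids (insert S \<T>)) = ?P (avoids \<T>) - ?P (\<lambda>A. S \<subseteq> A \<and> avoids \<T> A)"
    using subset_prob_conj_not[of I p "avoids \<T>" "\<lambda>A. S \<subseteq> A"]
    by (simp add: avoids_insert[abs_def] conj_commute)
  ultimately have "?P (avoids (insert S \<T>)) \<le> (1 - q) * ?P (avoids \<T>)"
    by (simp add: left_diff_distrib)
  also have "\<dots> \<le> exp (- q) * ?P (avoids \<T>)"
    using exp_ge_add_one_self[of "- q"] by (intro mult_right_mono) auto
  finally show ?thesis by (simp add: q_def)
qed

lemma janson_inequality:
  assumes "finite I" "finite \<T>"
  shows "subset_prob I p (avoids \<T>) \<le>
    exp (- (\<Sum>S\<in>\<T>. subset_prob I p (\<lambda>A. S \<subseteq> A)) +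
      (\<Sum>S\<in>\<T>. \<Sum>T\<in>{T\<in>\<T>. T \<noteq> S \<and> S \<inter> T \<noteq> {}}. subset_prob I p (\<lambda>A. S \<union> T \<subseteq> A)) / 2)"
proof -
  define w where "w S = subset_prob I p (\<lambda>A. S \<subseteq> A)" for S
  define g where "g S T = (if T \<noteq> S \<and> S \<inter> T \<noteq> {} then w (S \<union> T) else 0)" for S T
  have g_sym: "g T S = g S T" for S T
    by (auto simp: g_def Un_commute Int_commute)
  have "subset_prob I p (avoids \<T>) \<le> exp (- sum w \<T> + (\<Sum>S\<in>\<T>. sum (g S) \<T>) / 2)"
    using assms(2)
  proof (induction \<T> rule: finite_induct)
    case empty
    then show ?case by simp
  next
    case (insert S \<T>)
    have "(\<Sum>T\<in>{T\<in>\<T>. S \<inter> T \<noteq> {}}. w (S \<union> T)) = sum (g S) \<T>"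
      unfolding g_def sum.inter_filter[OF insert.hyps(1)] using insert.hyps(2)
      by (intro sum.cong) auto
    then have "subset_prob I p (avoids (insert S \<T>)) \<le>
        exp (- w S + sum (g S) \<T>) * subset_prob I p (avoids \<T>)"
      using subset_prob_avoids_insert_le[OF assms(1) insert.hyps(1), of p S] by (simp add: w_def)
    also have "\<dots> \<le> exp (- w S + sum (g S) \<T>) * exp (- sum w \<T> + (\<Sum>S\<in>\<T>. sum (g S) \<T>) / 2)"
      using insert.IH by (intro mult_left_mono) auto
    also have "\<dots> = exp (- sum w (insert S \<T>) + (\<Sum>S'\<in>insert S \<T>. sum (g S') (insert S \<T>)) / 2)"
    proof -
      have "g S S = 0" by (simp add: g_def)
      then have "(\<Sum>S'\<in>insert S \<T>. sum (g S') (insert S \<T>)) =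
          2 * sum (g S) \<T> + (\<Sum>S\<in>\<T>. sum (g S) \<T>)"
        using insert.hyps by (simp add: sum.distrib g_sym)
      then show ?thesis using insert.hyps by (simp add: mult_exp_exp)
    qed
    finally show ?case .
  qed
  then show ?thesis
    unfolding w_def g_def sum.inter_filter[OF assms(2)] .
qed

section \<open>The second moment method\<close>

lemma (in prob_space) prob_no_event_le:
  fixes F :: "'i \<Rightarrow> 'a set"
  assumes fin: "finite G" and F: "\<And>i. i \<in> G \<Longrightarrow> F i \<in> events"
    and pos: "0 < (\<Sum>i\<in>G. prob (F i))"
  shows "prob (space M - (\<Union>i\<in>G. F i)) \<le>
    (\<Sum>i\<in>G. \<Sum>j\<in>G. prob (F i \<inter> F j)) / (\<Sum>i\<in>G. prob (F i))\<^sup>2 - 1"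
proof -
  define Q where "Q = (\<Sum>i\<in>G. prob (F i))"
  define X :: "'a \<Rightarrow> real" where "X \<omega> = (\<Sum>i\<in>G. indicator (F i) \<omega>)" for \<omega>
  have integrable_ind: "integrable M (indicator A :: 'a \<Rightarrow> real)" if "A \<in> events" for A
    using that by (simp add: integrable_real_indicator less_top[symmetric])
  have X_sq: "(X \<omega>)\<^sup>2 = (\<Sum>i\<in>G. \<Sum>j\<in>G. indicator (F i \<inter> F j) \<omega>)" for \<omega>
    by (simp add: X_def power2_eq_square sum_product indicator_inter_arith)
  have integrable: "integrable M X" "integrable M (\<lambda>\<omega>. (X \<omega>)\<^sup>2)"
    unfolding X_sq unfolding X_def using F
    by (auto intro!: Bochner_Integration.integrable_sum integrable_ind)
  have mean: "expectation X = Q"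
    unfolding X_def Q_def using F
    by (subst Bochner_Integration.integral_sum) (auto intro: integrable_ind)
  have "variance X = expectation (\<lambda>\<omega>. (X \<omega>)\<^sup>2) - Q\<^sup>2"
    using variance_eq[OF integrable] by (simp add: mean)
  also have "expectation (\<lambda>\<omega>. (X \<omega>)\<^sup>2) = (\<Sum>i\<in>G. \<Sum>j\<in>G. prob (F i \<inter> F j))"
    unfolding X_sq using F by (simp add: Bochner_Integration.integral_sum integrable_ind sets.Int)
  finally have variance: "variance X = (\<Sum>i\<in>G. \<Sum>j\<in>G. prob (F i \<inter> F j)) - Q\<^sup>2" .
  have "space M - (\<Union>i\<in>G. F i) \<subseteq> {\<omega>\<in>space M. Q \<le> \<bar>X \<omega> - expectation X\<bar>}"
    using pos by (auto simp: X_def mean Q_def indicator_def)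
  then have "prob (space M - (\<Union>i\<in>G. F i)) \<le> prob {\<omega>\<in>space M. Q \<le> \<bar>X \<omega> - expectation X\<bar>}"
    using integrable(1) by (intro finite_measure_mono) auto
  also have "\<dots> \<le> variance X / Q\<^sup>2"
    using integrable pos by (intro Chebyshev_inequality) (auto simp: Q_def)
  also have "\<dots> = (\<Sum>i\<in>G. \<Sum>j\<in>G. prob (F i \<inter> F j)) / Q\<^sup>2 - 1"
    using pos by (simp add: variance diff_divide_distrib flip: Q_def)
  finally show ?thesis by (simp add: Q_def)
qed

lemma (in prob_space) sum_prob_Int_le_sparse_dependence:
  fixes F :: "'i \<Rightarrow> 'a set"
  assumes fin: "finite G" and F: "\<And>i. i \<in> G \<Longrightarrow> F i \<in> events"
    and pair: "\<And>i j. i \<in> G \<Longrightarrow> j \<in> G \<Longrightarrow> \<not> r i j \<Longrightarrow>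
      prob (F i \<inter> F j) \<le> (1 + \<epsilon>) * (prob (F i) * prob (F j))"
    and sparse: "\<And>i. i \<in> G \<Longrightarrow> real (card {j\<in>G. r i j}) \<le> D"
    and "0 \<le> \<epsilon>"
  defines "Q \<equiv> \<Sum>i\<in>G. prob (F i)"
  shows "(\<Sum>i\<in>G. \<Sum>j\<in>G. prob (F i \<inter> F j)) \<le> (1 + \<epsilon>) * Q\<^sup>2 + D * Q"
proof -
  have "prob (F i \<inter> F j) \<le>
      (1 + \<epsilon>) * (prob (F i) * prob (F j)) + (if r i j then prob (F i) else 0)"
    if "i \<in> G" "j \<in> G" for i j
  proof (cases "r i j")
    case True
    have "prob (F i \<inter> F j) \<le> prob (F i)" using F that by (intro finite_measure_mono) auto
    then show ?thesis using True \<open>0 \<le> \<epsilon>\<close> by (simp add: add_increasing)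
  qed (use pair that in simp)
  then have "(\<Sum>i\<in>G. \<Sum>j\<in>G. prob (F i \<inter> F j)) \<le>
      (\<Sum>i\<in>G. \<Sum>j\<in>G. (1 + \<epsilon>) * (prob (F i) * prob (F j)) + (if r i j then prob (F i) else 0))"
    by (intro sum_mono)
  also have "\<dots> = (1 + \<epsilon>) * Q\<^sup>2 + (\<Sum>i\<in>G. real (card {j\<in>G. r i j}) * prob (F i))"
  proof -
    have "(1 + \<epsilon>) * Q\<^sup>2 = (\<Sum>i\<in>G. \<Sum>j\<in>G. (1 + \<epsilon>) * (prob (F i) * prob (F j)))"
      by (simp add: Q_def power2_eq_square sum_product flip: sum_distrib_left)
    moreover have "(\<Sum>j\<in>G. if r i j then prob (F i) else 0) =
        real (card {j\<in>G. r i j}) * prob (F i)" for i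
      using fin by (simp flip: sum.inter_filter)
    ultimately show ?thesis by (simp add: sum.distrib)
  qed
  also have "(\<Sum>i\<in>G. real (card {j\<in>G. r i j}) * prob (F i)) \<le> D * Q"
    unfolding Q_def sum_distrib_left using sparse by (intro sum_mono mult_right_mono) auto
  finally show ?thesis by simp
qed

lemma (in prob_space) prob_no_event_le_sparse_dependence:
  fixes F :: "'i \<Rightarrow> 'a set"
  assumes "finite G" "\<And>i. i \<in> G \<Longrightarrow> F i \<in> events"
    and "\<And>i j. i \<in> G \<Longrightarrow> j \<in> G \<Longrightarrow> \<not> r i j \<Longrightarrow>
      prob (F i \<inter> F j) \<le> (1 + \<epsilon>) * (prob (F i) * prob (F j))"
    and "\<And>i. i \<in> G \<Longrightarrow> real (card {j\<in>G. r i j}) \<le> D"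
    and "0 \<le> \<epsilon>" and pos: "0 < (\<Sum>i\<in>G. prob (F i))"
  shows "prob (space M - (\<Union>i\<in>G. F i)) \<le> D / (\<Sum>i\<in>G. prob (F i)) + \<epsilon>"
proof -
  define Q where "Q = (\<Sum>i\<in>G. prob (F i))"
  have "(\<Sum>i\<in>G. \<Sum>j\<in>G. prob (F i \<inter> F j)) / Q\<^sup>2 \<le> ((1 + \<epsilon>) * Q\<^sup>2 + D * Q) / Q\<^sup>2"
    unfolding Q_def
    by (intro divide_right_mono sum_prob_Int_le_sparse_dependence[where r = r] assms) auto
  also have "\<dots> = D / Q + \<epsilon> + 1"
    using pos by (simp add: Q_def[symmetric] power2_eq_square field_simps)
  finally show ?thesis
    using prob_no_event_le[OF assms(1,2) pos] by (simp add: Q_def)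
qed

section \<open>Coefficients of negative binomial series\<close>

definition rising_coeff :: "'a::field_char_0 \<Rightarrow> nat \<Rightarrow> 'a" where
  "rising_coeff b n = pochhammer b n / fact n"

lemma rising_coeff_convolution:
  "(\<Sum>i=0..n. rising_coeff b i * rising_coeff c (n - i)) = rising_coeff (b + c) n"
proof -
  have "rising_coeff b i * rising_coeff c (n - i) =
      of_nat (n choose i) * pochhammer b i * pochhammer c (n - i) / fact n" if "i \<in> {0..n}" for i
    using that by (simp add: rising_coeff_def binomial_fact)
  then have "(\<Sum>i=0..n. rising_coeff b i * rising_coeff c (n - i)) =
      (\<Sum>i=0..n. of_nat (n choose i) * pochhammer b i * pochhammer c (n - i) / fact n)"
    by (rule sum.cong[OF refl])
  also have "\<dots> = rising_coeff (b + c) n"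
    by (simp add: rising_coeff_def pochhammer_binomial_sum sum_divide_distrib atMost_atLeast0)
  finally show ?thesis .
qed

lemma rising_coeff_0_left: "rising_coeff 0 n = of_bool (n = 0)"
  by (simp add: rising_coeff_def pochhammer_0_left)

lemma rising_coeff_1_left: "rising_coeff 1 n = 1"
  by (simp add: rising_coeff_def flip: pochhammer_fact)

lemma rising_coeff_Suc:
  "rising_coeff b (Suc n) = rising_coeff b n * ((b + of_nat n) / of_nat (Suc n))"
  by (simp add: rising_coeff_def pochhammer_Suc field_simps)

lemma fps_rising_coeff_power:
  "Abs_fps (rising_coeff b) ^ k = Abs_fps (rising_coeff (of_nat k * b))"
proof (induction k)
  case 0
  show ?case by (rule fps_ext) (simp add: rising_coeff_0_left)
next
  case (Suc k)
  then show ?case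
    by (intro fps_ext) (simp add: fps_mult_nth rising_coeff_convolution algebra_simps)
qed

lemma rising_coeff_nonneg: "0 \<le> b \<Longrightarrow> 0 \<le> rising_coeff (b :: real) n"
  unfolding rising_coeff_def pochhammer_prod by (intro divide_nonneg_nonneg prod_nonneg) auto

lemma rising_coeff_mono: "0 \<le> b \<Longrightarrow> b \<le> c \<Longrightarrow> rising_coeff b n \<le> rising_coeff (c :: real) n"
  unfolding rising_coeff_def pochhammer_prod by (intro divide_right_mono prod_mono) auto

lemma rising_coeff_one_minus_le_powr:
  assumes "0 \<le> a" "a \<le> 1"
  shows "rising_coeff (1 - a) n \<le> real (Suc n) powr (- a)"
proof (induction n)
  case 0
  then show ?case by (simp add: rising_coeff_def)
next
  case (Suc n)
  define t where "t = 1 / real (Suc n)"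
  have "0 < t" by (simp add: t_def)
  have "(1 - a + real n) / real (Suc n) = 1 - a * t" by (simp add: t_def field_simps)
  also have "\<dots> \<le> exp (- (a * t))"
    using exp_ge_add_one_self[of "- (a * t)"] by simp
  also have "\<dots> \<le> exp (- (a * ln (1 + t)))"
    using assms \<open>0 < t\<close> by (simp add: mult_left_mono ln_add_one_self_le_self)
  also have "\<dots> = (1 + t) powr (- a)"
    using \<open>0 < t\<close> by (simp add: powr_def)
  finally have "rising_coeff (1 - a) n * ((1 - a + real n) / real (Suc n)) \<le>
      real (Suc n) powr (- a) * (1 + t) powr (- a)"
    using Suc.IH assms by (intro mult_mono) auto
  also have "\<dots> = (real (Suc n) * (1 + t)) powr (- a)"
    using \<open>0 < t\<close> by (simp add: powr_mult)
  also have "real (Suc n) * (1 + t) = real (Suc (Suc n))" by (simp add: t_def field_simps)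
  finally show ?case by (simp add: rising_coeff_Suc)
qed

lemma Gamma_plus_one_le:
  fixes a x :: real
  assumes "0 \<le> a" "a \<le> 1" "0 < x + a"
  shows "Gamma (x + 1) \<le> Gamma (x + a) * (x + a) powr (1 - a)"
proof -
  have pos: "0 < Gamma (x + a)" using assms by (intro Gamma_real_pos)
  have "ln (Gamma (a * (x + a) + (1 - a) * (x + a + 1))) \<le>
      a * ln (Gamma (x + a)) + (1 - a) * ln (Gamma (x + a + 1))"
    using convex_onD[OF log_convex_Gamma_real, of "1 - a" "x + a" "x + a + 1"] assms by simp
  moreover have "a * (x + a) + (1 - a) * (x + a + 1) = x + 1" by (simp add: algebra_simps)
  moreover have "ln (Gamma (x + a + 1)) = ln (x + a) + ln (Gamma (x + a))"
    using assms pos by (subst Gamma_plus1) (auto dest: nonpos_Ints_nonpos simp: ln_mult_pos)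
  ultimately have "ln (Gamma (x + 1)) \<le> ln (Gamma (x + a)) + (1 - a) * ln (x + a)"
    by (simp add: algebra_simps)
  then have "exp (ln (Gamma (x + 1))) \<le> exp (ln (Gamma (x + a)) + (1 - a) * ln (x + a))"
    by (simp only: exp_le_cancel_iff)
  then show ?thesis
    using assms pos by (simp add: exp_add powr_def Gamma_real_pos)
qed

lemma Gamma_real_le_1:
  assumes "1 \<le> x" "x \<le> 2"
  shows "Gamma x \<le> (1 :: real)"
proof -
  have "ln (Gamma x) \<le> (2 - x) * ln (Gamma 1) + (x - 1) * ln (Gamma 2)"
    using convex_onD[OF log_convex_Gamma_real, of "x - 1" 1 2] assms by (simp add: algebra_simps)
  also have "\<dots> = 0" using Gamma_fact[of 1, where 'a = real] by simp
  finally show ?thesis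
    using assms by (simp add: Gamma_real_pos)
qed

lemma powr_le_Gamma_mult_rising_coeff:
  assumes "0 < a" "a \<le> 1"
  shows "real (Suc n) powr (a - 1) \<le> Gamma a * rising_coeff a n"
proof -
  have "fact n = Gamma (real n + 1)" by (simp add: Gamma_fact add.commute)
  also have "\<dots> \<le> Gamma (real n + a) * (real n + a) powr (1 - a)"
    using assms by (intro Gamma_plus_one_le) auto
  also have "\<dots> \<le> Gamma (real n + a) * real (Suc n) powr (1 - a)"
    using assms by (intro mult_left_mono powr_mono2) (auto intro: less_imp_le Gamma_real_pos)
  finally have "fact n * real (Suc n) powr (a - 1) \<le>
      Gamma (real n + a) * real (Suc n) powr (1 - a) * real (Suc n) powr (a - 1)"
    by (rule mult_right_mono) simp
  also have "\<dots> = Gamma (real n + a)"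
    by (simp add: mult.assoc flip: powr_add)
  also have "\<dots> = Gamma a * pochhammer a n"
  proof -
    have "a \<notin> \<int>\<^sub>\<le>\<^sub>0" using assms by (auto dest: nonpos_Ints_nonpos)
    then show ?thesis
      using Gamma_real_pos[OF assms(1)] by (simp add: pochhammer_Gamma add.commute)
  qed
  finally show ?thesis by (simp add: rising_coeff_def field_simps)
qed

section \<open>Weights of sums of distinct positive integers\<close>

definition summand_sets :: "nat \<Rightarrow> nat \<Rightarrow> nat set set" where
  "summand_sets k x = {S. finite S \<and> 0 \<notin> S \<and> card S = k \<and> \<Sum>S = x}"

lemma summand_sets_subset:
  assumes "S \<in> summand_sets k x"
  shows "S \<subseteq> {1..x}"
proof
  fix a assume "a \<in> S"
  then have "a \<le> \<Sum>S" "a \<noteq> 0"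
    using assms member_le_sum[of a S "\<lambda>a. a"] by (auto simp: summand_sets_def intro!: Nat.gr0I)
  then show "a \<in> {1..x}" using assms by (auto simp: summand_sets_def)
qed

lemma finite_summand_sets [simp]: "finite (summand_sets k x)"
  by (rule finite_subset[of _ "Pow {1..x}"]) (use summand_sets_subset in blast)+

lemma summand_sets_0: "summand_sets 0 x = (if x = 0 then {{}} else {})"
  by (auto simp: summand_sets_def)

lemma summand_sets_Diff_singleton:
  assumes "S \<in> summand_sets (Suc k) x" "a \<in> S"
  shows "a \<le> x" "S - {a} \<in> summand_sets k (x - a)"
proof -
  have "x = a + \<Sum>(S - {a})"
    using assms by (auto simp: summand_sets_def sum.remove)
  then show "a \<le> x" "S - {a} \<in> summand_sets k (x - a)"
    using assms by (auto simp: summand_sets_def)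
qed

lemma summand_sets_ex_ge_average:
  assumes "S \<in> summand_sets k x" "0 < k"
  shows "\<exists>a\<in>S. x \<le> k * a"
proof (rule ccontr)
  have S: "finite S" "card S = k" "\<Sum>S = x" using assms by (auto simp: summand_sets_def)
  assume "\<not> ?thesis"
  then have "(\<Sum>a\<in>S. k * a) < (\<Sum>a\<in>S. x)"
    using S assms(2) by (intro sum_strict_mono) auto
  then show False using S by (simp flip: sum_distrib_left)
qed

definition rep_weight :: "(nat \<Rightarrow> real) \<Rightarrow> nat \<Rightarrow> nat \<Rightarrow> real" where
  "rep_weight p k x = (\<Sum>S\<in>summand_sets k x. prod p S)"

lemma rep_weight_nonneg: "(\<And>a. 0 \<le> p a) \<Longrightarrow> 0 \<le> rep_weight p k x"
  unfolding rep_weight_def by (intro sum_nonneg prod_nonneg) auto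

lemma rep_weight_0_right: "1 \<le> k \<Longrightarrow> rep_weight p k 0 = 0"
  unfolding rep_weight_def
  by (rule sum.neutral) (use summand_sets_subset in \<open>fastforce simp: summand_sets_def\<close>)

lemma rep_weight_Suc_le:
  assumes "\<And>a. 0 \<le> p a"
  shows "real (Suc k) * rep_weight p (Suc k) x \<le> (\<Sum>a\<le>x. p a * rep_weight p k (x - a))"
proof -
  let ?\<S> = "\<lambda>a. {S\<in>summand_sets (Suc k) x. a \<in> S}"
  have fiber: "(\<Sum>S\<in>?\<S> a. prod p (S - {a})) \<le> rep_weight p k (x - a)" for a
  proof -
    have "inj_on (\<lambda>S. S - {a}) (?\<S> a)"
      by (rule inj_onI) (metis (mono_tags, lifting) insert_Diff mem_Collect_eq)
    then have "(\<Sum>S\<in>?\<S> a. prod p (S - {a})) = sum (prod p) ((\<lambda>S. S - {a}) ` ?\<S> a)"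
      by (simp add: sum.reindex)
    also have "\<dots> \<le> rep_weight p k (x - a)"
      unfolding rep_weight_def using assms summand_sets_Diff_singleton(2)
      by (intro sum_mono2) (auto intro: prod_nonneg)
    finally show ?thesis .
  qed
  have "real (Suc k) * rep_weight p (Suc k) x = (\<Sum>S\<in>summand_sets (Suc k) x. \<Sum>a\<in>S. prod p S)"
    unfolding rep_weight_def sum_distrib_left by (intro sum.cong) (auto simp: summand_sets_def)
  also have "\<dots> = (\<Sum>S\<in>summand_sets (Suc k) x. \<Sum>a\<in>{a\<in>{..x}. a \<in> S}. p a * prod p (S - {a}))"
  proof (intro sum.cong refl)
    fix S a assume S: "S \<in> summand_sets (Suc k) x"
    then show "S = {a\<in>{..x}. a \<in> S}"
      using summand_sets_subset by fastforce
    show "prod p S = p a * prod p (S - {a})" if "a \<in> {a\<in>{..x}. a \<in> S}"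
      using S that by (simp add: summand_sets_def prod.remove)
  qed
  also have "\<dots> = (\<Sum>a\<le>x. \<Sum>S\<in>?\<S> a. p a * prod p (S - {a}))"
    by (intro sum.swap_restrict) auto
  also have "\<dots> \<le> (\<Sum>a\<le>x. p a * rep_weight p k (x - a))"
    unfolding sum_distrib_left[symmetric] using assms fiber by (intro sum_mono mult_left_mono)
  finally show ?thesis .
qed

lemma fact_mult_rep_weight_le:
  assumes "\<And>a. 0 \<le> p a"
  shows "fact k * rep_weight p k x \<le> fps_nth (Abs_fps p ^ k) x"
proof (induction k arbitrary: x)
  case 0
  then show ?case by (simp add: rep_weight_def summand_sets_0)
next
  case (Suc k)
  have "fact (Suc k) * rep_weight p (Suc k) x = fact k * (real (Suc k) * rep_weight p (Suc k) x)"
    by simp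
  also have "\<dots> \<le> fact k * (\<Sum>a\<le>x. p a * rep_weight p k (x - a))"
    using assms by (intro mult_left_mono rep_weight_Suc_le) auto
  also have "\<dots> = (\<Sum>a\<le>x. p a * (fact k * rep_weight p k (x - a)))"
    by (simp add: sum_distrib_left mult_ac)
  also have "\<dots> \<le> (\<Sum>a\<le>x. p a * fps_nth (Abs_fps p ^ k) (x - a))"
    using assms by (intro sum_mono mult_left_mono Suc.IH)
  also have "\<dots> = fps_nth (Abs_fps p ^ Suc k) x"
    by (simp add: fps_mult_nth atMost_atLeast0)
  finally show ?case .
qed

lemma rep_weight_le_fps_power:
  assumes "\<And>a. 0 \<le> p a"
  shows "rep_weight p k x \<le> fps_nth (Abs_fps p ^ k) x"
proof -
  have "1 * rep_weight p k x \<le> fact k * rep_weight p k x"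
    using assms by (intro mult_right_mono rep_weight_nonneg) auto
  then show ?thesis using fact_mult_rep_weight_le[of p k x] assms by simp
qed

lemma fps_nth_power_nonneg:
  fixes f :: "'a::linordered_semidom fps"
  assumes "\<And>n. 0 \<le> fps_nth f n"
  shows "0 \<le> fps_nth (f ^ k) n"
  using assms by (induction k arbitrary: n) (auto simp: fps_mult_nth intro!: sum_nonneg)

lemma fps_nth_power_mono:
  fixes f g :: "'a::linordered_semidom fps"
  assumes "\<And>n. 0 \<le> fps_nth f n" "\<And>n. fps_nth f n \<le> fps_nth g n"
  shows "fps_nth (f ^ k) n \<le> fps_nth (g ^ k) n"
proof (induction k arbitrary: n)
  case (Suc k)
  then show ?case
    using assms
    by (auto simp: fps_mult_nth fps_nth_power_nonneg
        intro!: sum_mono mult_mono order.trans[OF assms])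
qed auto

definition overlap_weight :: "(nat \<Rightarrow> real) \<Rightarrow> nat \<Rightarrow> nat \<Rightarrow> nat \<Rightarrow> real" where
  "overlap_weight p k x y =
    (\<Sum>S\<in>summand_sets k x. \<Sum>T\<in>{T\<in>summand_sets k y. T \<noteq> S \<and> S \<inter> T \<noteq> {}}. prod p (S \<union> T))"

lemma card_Int_summand_sets:
  assumes S: "S \<in> summand_sets k x" and T: "T \<in> summand_sets k y" and "T \<noteq> S" "S \<inter> T \<noteq> {}"
  shows "card (S \<inter> T) \<in> {1..<k}"
proof -
  have fin: "finite S" "finite T" and card: "card S = k" "card T = k"
    using S T by (auto simp: summand_sets_def)
  have "card (S \<inter> T) \<noteq> k"
    using fin card card_subset_eq[of S "S \<inter> T"] card_subset_eq[of T "S \<inter> T"] assms(3) by auto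
  moreover have "card (S \<inter> T) \<le> k"
    using card_mono[of S "S \<inter> T"] fin card by simp
  moreover have "1 \<le> card (S \<inter> T)"
    using assms(4) fin by (simp add: Suc_le_eq card_gt_0_iff)
  ultimately show ?thesis by simp
qed

lemma Diff_in_summand_sets:
  assumes "S \<in> summand_sets k x"
  shows "\<Sum>(S \<inter> T) \<le> x" "S - T \<in> summand_sets (k - card (S \<inter> T)) (x - \<Sum>(S \<inter> T))"
proof -
  have S: "finite S" "0 \<notin> S" "card S = k" "\<Sum>S = x"
    using assms by (auto simp: summand_sets_def)
  have "x = \<Sum>(S \<inter> T) + \<Sum>(S - T)"
    using sum.Int_Diff[of S "\<lambda>a. a" T] S by simp
  then show "\<Sum>(S \<inter> T) \<le> x" "S - T \<in> summand_sets (k - card (S \<inter> T)) (x - \<Sum>(S \<inter> T))"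
    using S by (auto simp: summand_sets_def card_Diff_subset_Int)
qed

lemma prod_Un_eq_prod_Int_Diff:
  assumes "finite S" "finite T"
  shows "prod f (S \<union> T) = prod f (S \<inter> T) * prod f (S - T) * prod f (T - S)"
proof -
  have "S \<union> T = S \<union> (T - S)" by auto
  then have "prod f (S \<union> T) = prod f S * prod f (T - S)"
    using assms prod.union_disjoint[of S "T - S" f] by auto
  then show ?thesis using prod.Int_Diff[OF assms(1), of f T] by simp
qed

text \<open>
  A pair \<open>(S, T)\<close> of overlapping sets is encoded by the size and the sum of \<open>S \<inter> T\<close>, followed by
  \<open>S \<inter> T\<close>, \<open>S - T\<close> and \<open>T - S\<close>.
\<close>

definition overlap_codes ::
  "nat \<Rightarrow> nat \<Rightarrow> nat \<Rightarrow> (nat \<times> nat \<times> nat set \<times> nat set \<times> nat set) set" where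
  "overlap_codes k x y = Sigma {1..<k} (\<lambda>j. Sigma {..x} (\<lambda>u.
    summand_sets j u \<times> summand_sets (k - j) (x - u) \<times> summand_sets (k - j) (y - u)))"

lemma finite_overlap_codes: "finite (overlap_codes k x y)"
  by (auto simp: overlap_codes_def intro!: finite_SigmaI)

lemma overlap_code_mem:
  assumes S: "S \<in> summand_sets k x" and T: "T \<in> summand_sets k y" and ne: "T \<noteq> S" "S \<inter> T \<noteq> {}"
  shows "(card (S \<inter> T), \<Sum>(S \<inter> T), S \<inter> T, S - T, T - S) \<in> overlap_codes k x y"
proof -
  have "S \<inter> T \<in> summand_sets (card (S \<inter> T)) (\<Sum>(S \<inter> T))"
    using S by (auto simp: summand_sets_def)
  then show ?thesis
    using card_Int_summand_sets[OF S T ne] Diff_in_summand_sets[OF S, of T]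
      Diff_in_summand_sets[OF T, of S]
    by (simp add: overlap_codes_def Int_commute)
qed

lemma sum_overlap_codes:
  "(\<Sum>(j, u, U, V, W)\<in>overlap_codes k x y. prod p U * prod p V * prod p W) =
    (\<Sum>j\<in>{1..<k}. \<Sum>u\<le>x.
      rep_weight p j u * rep_weight p (k - j) (x - u) * rep_weight p (k - j) (y - u))"
proof -
  define \<C> where "\<C> j u =
    summand_sets j u \<times> summand_sets (k - j) (x - u) \<times> summand_sets (k - j) (y - u)" for j u
  define w where "w = (\<lambda>(U, V, W). prod p U * prod p V * prod p W)"
  have "(\<Sum>(j, u, c)\<in>overlap_codes k x y. w c) =
      (\<Sum>j\<in>{1..<k}. \<Sum>z\<in>Sigma {..x} (\<C> j). case z of (u, c) \<Rightarrow> w c)"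
    unfolding overlap_codes_def \<C>_def by (subst sum.Sigma) (auto intro!: finite_SigmaI)
  also have "\<dots> = (\<Sum>j\<in>{1..<k}. \<Sum>u\<le>x. sum w (\<C> j u))"
    by (intro sum.cong refl, subst sum.Sigma) (auto simp: \<C>_def)
  also have "\<dots> = (\<Sum>j\<in>{1..<k}. \<Sum>u\<le>x.
      rep_weight p j u * rep_weight p (k - j) (x - u) * rep_weight p (k - j) (y - u))"
    unfolding rep_weight_def w_def \<C>_def
    by (intro sum.cong refl)
      (simp add: mult.assoc flip: sum.cartesian_product sum_distrib_left sum_distrib_right)
  finally show ?thesis by (simp add: w_def case_prod_beta')
qed

lemma overlap_weight_le:
  assumes "\<And>a. 0 \<le> p a"
  shows "overlap_weight p k x y \<le> (\<Sum>j\<in>{1..<k}. \<Sum>u\<le>x.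
    rep_weight p j u * rep_weight p (k - j) (x - u) * rep_weight p (k - j) (y - u))"
proof -
  define \<P> where "\<P> = Sigma (summand_sets k x) (\<lambda>S. {T\<in>summand_sets k y. T \<noteq> S \<and> S \<inter> T \<noteq> {}})"
  define w where "w = (\<lambda>(j :: nat, u :: nat, U, V, W). prod p U * prod p V * prod p W)"
  have "overlap_weight p k x y = (\<Sum>(S, T)\<in>\<P>. prod p (S \<union> T))"
    unfolding overlap_weight_def \<P>_def by (rule sum.Sigma) auto
  also have "\<dots> \<le> sum w (overlap_codes k x y)"
  proof (rule sum_le_included[where i = "\<lambda>(j, u, U, V, W). (U \<union> V, U \<union> W)"])
    show "finite \<P>" by (auto simp: \<P>_def)
    show "\<forall>c\<in>overlap_codes k x y. 0 \<le> w c"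
      using assms by (auto simp: w_def intro!: mult_nonneg_nonneg prod_nonneg)
    show "\<forall>z\<in>\<P>. \<exists>c\<in>overlap_codes k x y. (case c of (j, u, U, V, W) \<Rightarrow> (U \<union> V, U \<union> W)) = z \<and>
        (case z of (S, T) \<Rightarrow> prod p (S \<union> T)) \<le> w c"
    proof (clarify, rule bexI)
      fix S T assume "(S, T) \<in> \<P>"
      then have ST: "S \<in> summand_sets k x" "T \<in> summand_sets k y" "T \<noteq> S" "S \<inter> T \<noteq> {}"
        by (auto simp: \<P>_def)
      then have "finite S" "finite T" by (auto simp: summand_sets_def)
      let ?c = "(card (S \<inter> T), \<Sum>(S \<inter> T), S \<inter> T, S - T, T - S)"
      show "(case ?c of (j, u, U, V, W) \<Rightarrow> (U \<union> V, U \<union> W)) = (S, T) \<and> prod p (S \<union> T) \<le> w ?c"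
        using prod_Un_eq_prod_Int_Diff[OF \<open>finite S\<close> \<open>finite T\<close>, of p] by (auto simp: w_def)
      show "?c \<in> overlap_codes k x y" using ST by (rule overlap_code_mem)
    qed
  qed (rule finite_overlap_codes)
  finally show ?thesis unfolding w_def sum_overlap_codes .
qed

section \<open>Weight estimates for pseudo powers\<close>

definition pseudo_prob :: "nat \<Rightarrow> nat \<Rightarrow> real" where
  "pseudo_prob s n = 1 / real s * real n powr (- 1 + 1 / real s)"

lemma lambda_const_eq: "lambda_const s = (Gamma (1 / real s) / real s) ^ s / fact s"
  by (simp add: lambda_const_def power_divide)

locale pseudo_power =
  fixes s :: nat
  assumes s_ge_2: "2 \<le> s"
begin

abbreviation p :: "nat \<Rightarrow> real" where "p \<equiv> pseudo_prob s"
abbreviation \<alpha> :: real where "\<alpha> \<equiv> 1 / real s"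

lemma \<alpha>_pos: "0 < \<alpha>" and \<alpha>_le_half: "\<alpha> \<le> 1 / 2"
  using s_ge_2 by (auto simp: field_simps)

lemma \<alpha>_sq_le: "\<alpha>\<^sup>2 \<le> \<alpha>"
  using mult_left_mono[of \<alpha> 1 \<alpha>] \<alpha>_pos \<alpha>_le_half by (simp add: power2_eq_square)

lemma p_nonneg: "0 \<le> p n"
  by (simp add: pseudo_prob_def)

lemma p_le_powr:
  assumes "0 < n"
  shows "p n \<le> real n powr (- \<alpha>)"
proof -
  have "p n \<le> 1 * real n powr (- 1 + \<alpha>)"
    unfolding pseudo_prob_def using \<alpha>_le_half by (intro mult_right_mono) auto
  also have "\<dots> \<le> real n powr (- \<alpha>)"
    using assms \<alpha>_le_half by (simp add: powr_mono)
  finally show ?thesis .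
qed

lemma p_le_1: "p n \<le> 1"
proof (cases "n = 0")
  case False
  then have "real n powr (- \<alpha>) \<le> real n powr 0"
    using \<alpha>_pos by (intro powr_mono) auto
  then show ?thesis using p_le_powr[of n] False by simp
qed (simp add: pseudo_prob_def)

lemma divide_powr_minus_le:
  assumes "0 < x"
  shows "(x / real s) powr (- \<alpha>) \<le> real s * x powr (- \<alpha>)"
proof -
  have "(x / real s) powr (- \<alpha>) = real s powr \<alpha> * x powr (- \<alpha>)"
    using assms s_ge_2 by (simp add: powr_divide powr_minus field_simps)
  also have "\<dots> \<le> real s powr 1 * x powr (- \<alpha>)"
    using s_ge_2 \<alpha>_le_half by (intro mult_right_mono powr_mono) auto
  finally show ?thesis using s_ge_2 by simp
qed

lemma prod_p_le_powr:
  assumes "S \<in> summand_sets s x" "1 \<le> x"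
  shows "prod p S \<le> real s * real x powr (- \<alpha>)"
proof -
  obtain a where a: "a \<in> S" "x \<le> s * a"
    using summand_sets_ex_ge_average[OF assms(1)] s_ge_2 by auto
  then have "0 < a" using assms(2) by (cases a) auto
  have "real x \<le> real (s * a)" using a(2) by (rule of_nat_mono)
  then have "real x / real s \<le> real a" using s_ge_2 by (simp add: field_simps)
  have "prod p S = p a * prod p (S - {a})"
    using a assms(1) by (simp add: summand_sets_def prod.remove)
  also have "\<dots> \<le> p a * 1"
    by (intro mult_left_mono prod_le_1) (auto simp: p_nonneg p_le_1)
  also have "\<dots> \<le> real a powr (- \<alpha>)" using p_le_powr[OF \<open>0 < a\<close>] by simp
  also have "\<dots> \<le> (real x / real s) powr (- \<alpha>)"
    using assms s_ge_2 \<alpha>_pos \<open>real x / real s \<le> real a\<close> by (intro powr_mono2') auto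
  also have "\<dots> \<le> real s * real x powr (- \<alpha>)"
    using assms(2) by (intro divide_powr_minus_le) simp
  finally show ?thesis .
qed

text \<open>
  \<open>p n\<close> is at most \<open>Gamma \<alpha> / s\<close> times the \<open>n\<close>-th coefficient of \<open>z (1 - z) powr (- \<alpha>)\<close>. Since the
  \<open>s\<close>-th power of \<open>(1 - z) powr (- \<alpha>)\<close> is \<open>1 / (1 - z)\<close>, this loses nothing in the constant of
  \<open>rep_weight_s_le\<close>.
\<close>

lemma p_Suc_le: "p (Suc n) \<le> Gamma \<alpha> / real s * rising_coeff \<alpha> n"
proof -
  have "real (Suc n) powr (\<alpha> - 1) / real s \<le> Gamma \<alpha> * rising_coeff \<alpha> n / real s"
    using \<alpha>_pos \<alpha>_le_half by (intro divide_right_mono powr_le_Gamma_mult_rising_coeff) auto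
  then show ?thesis by (simp add: pseudo_prob_def)
qed

lemma Gamma_divide_s_pos: "0 < Gamma \<alpha> / real s"
  using \<alpha>_pos Gamma_real_pos[of \<alpha>] s_ge_2 by (intro divide_pos_pos) auto

lemma Gamma_divide_s_le_1: "Gamma \<alpha> / real s \<le> 1"
proof -
  have "Gamma \<alpha> / real s = Gamma (\<alpha> + 1)"
    using \<alpha>_pos by (subst Gamma_plus1) (auto dest: nonpos_Ints_nonpos)
  then show ?thesis using Gamma_real_le_1[of "\<alpha> + 1"] \<alpha>_pos \<alpha>_le_half by simp
qed

lemma fps_p_power_le:
  "fps_nth (Abs_fps p ^ k) x \<le>
    (Gamma \<alpha> / real s) ^ k * (if x < k then 0 else rising_coeff (real k * \<alpha>) (x - k))"
proof -
  let ?majorant = "fps_const (Gamma \<alpha> / real s) * (fps_X * Abs_fps (rising_coeff \<alpha>))"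
  have "fps_nth (Abs_fps p) n \<le> fps_nth ?majorant n" for n
  proof (cases n)
    case 0
    then show ?thesis by (simp add: pseudo_prob_def)
  next
    case (Suc m)
    then show ?thesis using p_Suc_le[of m] by simp
  qed
  then have "fps_nth (Abs_fps p ^ k) x \<le> fps_nth (?majorant ^ k) x"
    by (intro fps_nth_power_mono) (auto simp: p_nonneg)
  also have "?majorant ^ k = fps_const ((Gamma \<alpha> / real s) ^ k) *
      (fps_X ^ k * Abs_fps (rising_coeff (real k * \<alpha>)))"
    by (simp only: power_mult_distrib fps_rising_coeff_power fps_const_power)
  finally show ?thesis
    by (simp add: fps_X_power_mult_nth cong: if_cong)
qed

lemma fps_p_power_le_rising_coeff:
  "fps_nth (Abs_fps p ^ k) x \<le> (if x < k then 0 else rising_coeff (real k * \<alpha>) (x - k))"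
    (is "_ \<le> ?c")
proof -
  have "0 \<le> ?c" using \<alpha>_pos by (simp add: rising_coeff_nonneg)
  moreover have "(Gamma \<alpha> / real s) ^ k \<le> 1"
    using Gamma_divide_s_pos Gamma_divide_s_le_1 by (intro power_le_one) auto
  ultimately have "(Gamma \<alpha> / real s) ^ k * ?c \<le> 1 * ?c"
    by (intro mult_right_mono)
  then show ?thesis using fps_p_power_le[of k x] by simp
qed

lemma fps_p_power_le_1:
  assumes "k \<le> s"
  shows "fps_nth (Abs_fps p ^ k) x \<le> 1"
proof -
  have "rising_coeff (real k * \<alpha>) n \<le> 1" for n
    using rising_coeff_mono[of "real k * \<alpha>" 1 n] assms s_ge_2 by (simp add: rising_coeff_1_left)
  then show ?thesis
    using fps_p_power_le_rising_coeff[of k x] by (auto intro: order.trans split: if_splits)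
qed

lemma rep_weight_s_le: "rep_weight p s x \<le> lambda_const s"
proof -
  have "fact s * rep_weight p s x \<le> fps_nth (Abs_fps p ^ s) x"
    by (intro fact_mult_rep_weight_le p_nonneg)
  also have "\<dots> \<le>
      (Gamma \<alpha> / real s) ^ s * (if x < s then 0 else rising_coeff (real s * \<alpha>) (x - s))"
    by (rule fps_p_power_le)
  also have "\<dots> \<le> (Gamma \<alpha> / real s) ^ s"
    using s_ge_2 Gamma_divide_s_pos by (simp add: rising_coeff_1_left)
  finally show ?thesis
    unfolding lambda_const_eq by (subst pos_le_divide_eq) (auto simp: mult.commute)
qed

lemma lambda_const_pos: "0 < lambda_const s"
  unfolding lambda_const_eq by (intro divide_pos_pos zero_less_power Gamma_divide_s_pos) simp

lemma lambda_const_le_1: "lambda_const s \<le> 1"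
proof -
  have "(Gamma \<alpha> / real s) ^ s / fact s \<le> 1 / 1"
    using Gamma_divide_s_pos Gamma_divide_s_le_1 by (intro frac_le power_le_one) auto
  then show ?thesis by (simp add: lambda_const_eq)
qed

lemma rep_weight_le_1: "k \<le> s \<Longrightarrow> rep_weight p k x \<le> 1"
  using rep_weight_le_fps_power[OF p_nonneg] fps_p_power_le_1 by (rule order.trans)

lemma rep_weight_le_powr:
  assumes "1 \<le> k" "k < s"
  shows "rep_weight p k x \<le> real s * real x powr (- \<alpha>)"
proof (cases "x < k")
  case True
  then have "rep_weight p k x \<le> 0"
    using rep_weight_le_fps_power[of p k x, OF p_nonneg] fps_p_power_le_rising_coeff[of k x]
    by simp
  also have "0 \<le> real s * real x powr (- \<alpha>)" by simp
  finally show ?thesis .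
next
  case False
  have "x \<le> Suc (x - k) * k"
  proof -
    obtain d where "x = k + d" using False le_Suc_ex by (metis not_less)
    then show ?thesis using assms by (simp add: algebra_simps)
  qed
  also have "\<dots> \<le> Suc (x - k) * s" using assms by (intro mult_left_mono) auto
  finally have "real x \<le> real (Suc (x - k)) * real s" by (metis of_nat_le_iff of_nat_mult)
  then have "real x / real s \<le> real (Suc (x - k))"
    using s_ge_2 by (simp add: pos_divide_le_eq del: of_nat_Suc)
  have "real k \<le> real s - 1" using assms by linarith
  then have "real k * \<alpha> \<le> 1 - \<alpha>" using s_ge_2 by (simp add: field_simps)
  have "rep_weight p k x \<le> rising_coeff (real k * \<alpha>) (x - k)"
    using rep_weight_le_fps_power[of p k x, OF p_nonneg] fps_p_power_le_rising_coeff[of k x] False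
    by simp
  also have "\<dots> \<le> rising_coeff (1 - \<alpha>) (x - k)"
    using \<open>real k * \<alpha> \<le> 1 - \<alpha>\<close> by (intro rising_coeff_mono) auto
  also have "\<dots> \<le> real (Suc (x - k)) powr (- \<alpha>)"
    using \<alpha>_pos \<alpha>_le_half by (intro rising_coeff_one_minus_le_powr) auto
  also have "\<dots> \<le> (real x / real s) powr (- \<alpha>)"
    using assms False \<alpha>_pos \<open>real x / real s \<le> real (Suc (x - k))\<close> by (intro powr_mono2') auto
  also have "\<dots> \<le> real s * real x powr (- \<alpha>)"
    using assms False by (intro divide_powr_minus_le) auto
  finally show ?thesis .
qed

lemma sum_rep_weight_mult_le_1:
  assumes "j + k \<le> s"
  shows "(\<Sum>u\<le>x. rep_weight p j u * rep_weight p k (x - u)) \<le> 1"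
proof -
  have "(\<Sum>u\<le>x. rep_weight p j u * rep_weight p k (x - u)) \<le>
      (\<Sum>u\<le>x. fps_nth (Abs_fps p ^ j) u * fps_nth (Abs_fps p ^ k) (x - u))"
    by (intro sum_mono mult_mono rep_weight_le_fps_power rep_weight_nonneg fps_nth_power_nonneg)
      (auto simp: p_nonneg)
  also have "\<dots> = fps_nth (Abs_fps p ^ (j + k)) x"
    by (simp add: power_add fps_mult_nth atMost_atLeast0)
  also have "\<dots> \<le> 1" using assms by (rule fps_p_power_le_1)
  finally show ?thesis .
qed

text \<open>
  In the sum over the common part \<open>u\<close>, the third factor is small unless \<open>u\<close> lies within \<open>t\<close> of
  \<open>y\<close>, and then the first factor is.
\<close>

lemma rep_weight_triple_le:
  assumes j: "1 \<le> j" "j < s" and y: "0 < y" and t: "0 < t" "t \<le> real y / 2"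
  shows "rep_weight p j u * rep_weight p (s - j) v * rep_weight p (s - j) (y - u) \<le>
    rep_weight p j u * rep_weight p (s - j) v * (real s * t powr (- \<alpha>)) +
    (if u \<in> {y - nat \<lfloor>t\<rfloor>..<y} then real s * (real y / 2) powr (- \<alpha>) else 0)"
    (is "?w j u * ?w (s - j) v * ?w (s - j) (y - u) \<le> ?far + ?near")
proof (cases "real y - t < real u \<and> u < y")
  case True
  then have "u \<in> {y - nat \<lfloor>t\<rfloor>..<y}" by simp linarith
  have "?w j u * ?w (s - j) v * ?w (s - j) (y - u) \<le> real s * real u powr (- \<alpha>) * 1 * 1"
    using j
    by (intro mult_mono rep_weight_le_powr rep_weight_le_1) (auto simp: rep_weight_nonneg p_nonneg)
  also have "\<dots> \<le> ?near"
    using \<open>u \<in> _\<close> True y t \<alpha>_pos by (auto intro!: mult_left_mono powr_mono2')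
  also have "\<dots> \<le> ?far + ?near"
    by (simp add: rep_weight_nonneg p_nonneg)
  finally show ?thesis .
next
  case False
  have "?w (s - j) (y - u) \<le> real s * t powr (- \<alpha>)"
  proof (cases "u < y")
    case True
    then have "t \<le> real (y - u)" using False by (simp add: of_nat_diff)
    have "?w (s - j) (y - u) \<le> real s * real (y - u) powr (- \<alpha>)"
      using j by (intro rep_weight_le_powr) auto
    also have "\<dots> \<le> real s * t powr (- \<alpha>)"
      using \<open>t \<le> real (y - u)\<close> t \<alpha>_pos by (intro mult_left_mono powr_mono2') auto
    finally show ?thesis .
  qed (use j in \<open>simp add: rep_weight_0_right\<close>)
  then have "?w j u * ?w (s - j) v * ?w (s - j) (y - u) \<le> ?far"
    by (intro mult_left_mono) (auto simp: rep_weight_nonneg p_nonneg)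
  also have "\<dots> \<le> ?far + ?near" by simp
  finally show ?thesis .
qed

lemma sum_rep_weight_triple_le:
  assumes "1 \<le> j" "j < s" "0 < y" "0 < t" "t \<le> real y / 2"
  shows "(\<Sum>u\<le>x. rep_weight p j u * rep_weight p (s - j) (x - u) * rep_weight p (s - j) (y - u)) \<le>
    real s * (t powr (- \<alpha>) + t * (real y / 2) powr (- \<alpha>))"
proof -
  let ?far = "real s * t powr (- \<alpha>)" and ?near = "real s * (real y / 2) powr (- \<alpha>)"
  let ?J = "{y - nat \<lfloor>t\<rfloor>..<y}"
  have "(\<Sum>u\<le>x. rep_weight p j u * rep_weight p (s - j) (x - u) * rep_weight p (s - j) (y - u)) \<le>
      (\<Sum>u\<le>x. rep_weight p j u * rep_weight p (s - j) (x - u)) * ?far +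
      (\<Sum>u\<le>x. if u \<in> ?J then ?near else 0)"
    unfolding sum_distrib_right sum.distrib[symmetric] using assms
    by (intro sum_mono rep_weight_triple_le)
  also have "\<dots> \<le> 1 * ?far + t * ?near"
  proof (rule add_mono)
    show "(\<Sum>u\<le>x. rep_weight p j u * rep_weight p (s - j) (x - u)) * ?far \<le> 1 * ?far"
      using assms by (intro mult_right_mono sum_rep_weight_mult_le_1) auto
    have "card ({..x} \<inter> ?J) \<le> card ?J" by (intro card_mono) auto
    then have "real (card ({..x} \<inter> ?J)) \<le> t" using assms by simp linarith
    then have "real (card ({..x} \<inter> ?J)) * ?near \<le> t * ?near"
      by (intro mult_right_mono) auto
    then show "(\<Sum>u\<le>x. if u \<in> ?J then ?near else 0) \<le> t * ?near"
      by (subst sum.inter_restrict[symmetric]) simp_all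
  qed
  finally show ?thesis by (simp add: algebra_simps)
qed

text \<open>
  The cutoff \<open>t = y powr (\<alpha> / 2)\<close> makes both terms of this bound at most of order
  \<open>y powr (- \<alpha>\<^sup>2 / 2)\<close>.
\<close>

lemma cutoff_le_half:
  assumes "4 \<le> y"
  shows "y powr (\<alpha> / 2) \<le> y / 2"
proof -
  have "y powr (\<alpha> / 2) \<le> y powr (1 / 2)"
    using assms \<alpha>_le_half by (intro powr_mono) auto
  also have "\<dots> = sqrt y" using assms by (simp add: powr_half_sqrt)
  also have "\<dots> \<le> y / 2"
    using assms by (intro real_le_lsqrt) (auto simp: power2_eq_square)
  finally show ?thesis .
qed

lemma cutoff_terms_le:
  assumes "1 \<le> y"
  shows "(y powr (\<alpha> / 2)) powr (- \<alpha>) + y powr (\<alpha> / 2) * (y / 2) powr (- \<alpha>) \<le>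
    3 * y powr (- (\<alpha>\<^sup>2 / 2))"
proof -
  have "(y powr (\<alpha> / 2)) powr (- \<alpha>) = y powr (- (\<alpha>\<^sup>2 / 2))"
    by (simp add: powr_powr power2_eq_square mult_ac)
  moreover have "y powr (\<alpha> / 2) * (y / 2) powr (- \<alpha>) \<le> 2 * y powr (- (\<alpha>\<^sup>2 / 2))"
  proof -
    have "(y / 2) powr (- \<alpha>) = 2 powr \<alpha> * y powr (- \<alpha>)"
      using assms by (simp add: powr_divide powr_minus field_simps)
    also have "\<dots> \<le> 2 powr 1 * y powr (- \<alpha>)"
      using \<alpha>_le_half by (intro mult_right_mono powr_mono) auto
    finally have "y powr (\<alpha> / 2) * (y / 2) powr (- \<alpha>) \<le> y powr (\<alpha> / 2) * (2 * y powr (- \<alpha>))"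
      by (intro mult_left_mono) auto
    also have "\<dots> = 2 * y powr (- (\<alpha> / 2))"
      by (simp add: mult.commute flip: powr_add)
    also have "\<dots> \<le> 2 * y powr (- (\<alpha>\<^sup>2 / 2))"
      using assms \<alpha>_sq_le by (intro mult_left_mono powr_mono) auto
    finally show ?thesis .
  qed
  ultimately show ?thesis by linarith
qed

definition weight_bound :: "nat \<Rightarrow> real" where
  "weight_bound L = 3 * real s ^ 2 * real L powr (- (\<alpha>\<^sup>2 / 2))"

lemma weight_bound_nonneg: "0 \<le> weight_bound L"
  by (simp add: weight_bound_def)

lemma weight_bound_antimono: "0 < L \<Longrightarrow> L \<le> L' \<Longrightarrow> weight_bound L' \<le> weight_bound L"
  unfolding weight_bound_def by (intro mult_left_mono powr_mono2') auto

lemma prod_p_le_weight_bound: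
  assumes "S \<in> summand_sets s x" "1 \<le> x"
  shows "prod p S \<le> weight_bound x"
proof -
  have "prod p S \<le> real s * real x powr (- \<alpha>)" by (rule prod_p_le_powr[OF assms])
  also have "\<dots> \<le> 3 * real s ^ 2 * real x powr (- (\<alpha>\<^sup>2 / 2))"
  proof (intro mult_mono powr_mono)
    show "real s \<le> 3 * real s ^ 2" using s_ge_2 by (simp add: power2_eq_square)
    show "- \<alpha> \<le> - (\<alpha>\<^sup>2 / 2)" using \<alpha>_sq_le \<alpha>_pos by linarith
  qed (use assms in auto)
  finally show ?thesis by (simp add: weight_bound_def)
qed

lemma overlap_weight_le_weight_bound:
  assumes "4 \<le> y"
  shows "overlap_weight p s x y \<le> weight_bound y"
proof -
  let ?t = "real y powr (\<alpha> / 2)" and ?\<theta> = "real y powr (- (\<alpha>\<^sup>2 / 2))"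
  have "0 < ?t" using assms by simp
  have "?t \<le> real y / 2" using assms by (intro cutoff_le_half) simp
  have "overlap_weight p s x y \<le> (\<Sum>j\<in>{1..<s}. \<Sum>u\<le>x.
      rep_weight p j u * rep_weight p (s - j) (x - u) * rep_weight p (s - j) (y - u))"
    by (intro overlap_weight_le p_nonneg)
  also have "\<dots> \<le> (\<Sum>j\<in>{1..<s}. real s * (?t powr (- \<alpha>) + ?t * (real y / 2) powr (- \<alpha>)))"
    using assms \<open>0 < ?t\<close> \<open>?t \<le> real y / 2\<close> by (intro sum_mono sum_rep_weight_triple_le) auto
  also have "\<dots> \<le> (\<Sum>j\<in>{1..<s}. real s * (3 * ?\<theta>))"
    using assms by (intro sum_mono mult_left_mono cutoff_terms_le) auto
  also have "\<dots> \<le> real s * (real s * (3 * ?\<theta>))"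
    by (auto intro!: mult_left_mono mult_right_mono)
  finally show ?thesis
    by (simp add: weight_bound_def power2_eq_square mult_ac)
qed

end

section \<open>Avoiding prescribed sums\<close>

definition sum_sets :: "nat \<Rightarrow> nat set \<Rightarrow> nat set set" where
  "sum_sets k Z = (\<Union>x\<in>Z. summand_sets k x)"

lemma finite_sum_sets: "finite Z \<Longrightarrow> finite (sum_sets k Z)"
  by (simp add: sum_sets_def)

lemma sum_sets_Un: "sum_sets k (Y \<union> Z) = sum_sets k Y \<union> sum_sets k Z"
  by (auto simp: sum_sets_def)

lemma sum_sets_subset: "Z \<subseteq> {..n} \<Longrightarrow> S \<in> sum_sets k Z \<Longrightarrow> S \<subseteq> {1..n}"
  using summand_sets_subset by (fastforce simp: sum_sets_def)

lemma sum_over_sum_sets: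
  "finite Z \<Longrightarrow> (\<Sum>S\<in>sum_sets k Z. f S) = (\<Sum>x\<in>Z. \<Sum>S\<in>summand_sets k x. f S)"
  unfolding sum_sets_def by (rule sum.UNION_disjoint) (simp, simp, force simp: summand_sets_def)

context pseudo_power
begin

definition expected_reps :: "nat set \<Rightarrow> real" where
  "expected_reps Z = (\<Sum>x\<in>Z. rep_weight p s x)"

lemma expected_reps_le: "expected_reps Z \<le> lambda_const s * real (card Z)"
  using sum_bounded_above[of Z "rep_weight p s" "lambda_const s"] rep_weight_s_le
  by (simp add: expected_reps_def mult.commute)

lemma expected_reps_le_card: "expected_reps Z \<le> real (card Z)"
  using expected_reps_le mult_right_mono[OF lambda_const_le_1, of "real (card Z)"]
  by (auto intro: order.trans)

lemma subset_prob_p_superset: "S \<subseteq> {1..N} \<Longrightarrow> subset_prob {1..N} p (\<lambda>A. S \<subseteq> A) = prod p S"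
  by (intro subset_prob_superset) (auto simp: p_nonneg p_le_1)

lemma sum_subset_prob_sum_sets:
  assumes "Z \<subseteq> {..N}"
  shows "(\<Sum>S\<in>sum_sets s Z. subset_prob {1..N} p (\<lambda>A. S \<subseteq> A)) = expected_reps Z"
proof -
  have "finite Z" using assms finite_subset by blast
  have "(\<Sum>S\<in>sum_sets s Z. subset_prob {1..N} p (\<lambda>A. S \<subseteq> A)) = (\<Sum>S\<in>sum_sets s Z. prod p S)"
    using assms by (intro sum.cong refl subset_prob_p_superset sum_sets_subset)
  then show ?thesis
    using \<open>finite Z\<close> by (simp add: sum_over_sum_sets expected_reps_def rep_weight_def)
qed

lemma exp_le_subset_prob_avoids_sum_sets:
  assumes Z: "Z \<subseteq> {L..N}" and L: "4 \<le> L" "weight_bound L \<le> 1 / 2"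
  shows "exp (- (1 + 2 * weight_bound L) * expected_reps Z) \<le>
    subset_prob {1..N} p (avoids (sum_sets s Z))"
proof -
  have "finite Z" using Z finite_subset by blast
  have Z_le: "Z \<subseteq> {..N}" using Z by auto
  have "subset_prob {1..N} p (\<lambda>A. S \<subseteq> A) \<le> weight_bound L" if S: "S \<in> sum_sets s Z" for S
  proof -
    obtain x where x: "x \<in> Z" "S \<in> summand_sets s x" using S by (auto simp: sum_sets_def)
    then have "L \<le> x" using Z by auto
    have "prod p S \<le> weight_bound x"
      using x(2) \<open>L \<le> x\<close> L(1) by (intro prod_p_le_weight_bound) auto
    also have "\<dots> \<le> weight_bound L"
      using \<open>L \<le> x\<close> L(1) by (intro weight_bound_antimono) auto
    finally show ?thesis
      using subset_prob_p_superset[OF sum_sets_subset[OF Z_le S]] by simp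
  qed
  then show ?thesis
    unfolding sum_subset_prob_sum_sets[OF Z_le, symmetric] using L(2) \<open>finite Z\<close>
    by (intro exp_le_subset_prob_avoids finite_sum_sets) auto
qed

lemma subset_prob_avoids_sum_sets_le:
  assumes Z: "Z \<subseteq> {L..N}" and L: "4 \<le> L"
  shows "subset_prob {1..N} p (avoids (sum_sets s Z)) \<le>
    exp (- expected_reps Z + (real (card Z))\<^sup>2 * weight_bound L / 2)"
proof -
  have fin: "finite Z" using Z finite_subset by blast
  have Z_le: "Z \<subseteq> {..N}" using Z by auto
  let ?overlapping = "\<lambda>\<T> S. {T\<in>\<T>. T \<noteq> S \<and> S \<inter> T \<noteq> {}}"
  have "(\<Sum>S\<in>sum_sets s Z. \<Sum>T\<in>?overlapping (sum_sets s Z) S.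
        subset_prob {1..N} p (\<lambda>A. S \<union> T \<subseteq> A)) =
      (\<Sum>S\<in>sum_sets s Z. \<Sum>T\<in>?overlapping (sum_sets s Z) S. prod p (S \<union> T))"
    using sum_sets_subset[OF Z_le] by (intro sum.cong refl subset_prob_p_superset) auto
  also have "\<dots> =
      (\<Sum>S\<in>sum_sets s Z. \<Sum>y\<in>Z. \<Sum>T\<in>?overlapping (summand_sets s y) S. prod p (S \<union> T))"
    using fin by (simp add: sum.inter_filter finite_sum_sets sum_over_sum_sets)
  also have "\<dots> = (\<Sum>x\<in>Z. \<Sum>y\<in>Z. overlap_weight p s x y)"
    unfolding overlap_weight_def sum_over_sum_sets[OF fin] by (intro sum.cong refl sum.swap)
  also have "\<dots> \<le> (\<Sum>x\<in>Z. \<Sum>y\<in>Z. weight_bound L)"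
  proof (intro sum_mono)
    fix x y assume "y \<in> Z"
    then have "L \<le> y" using Z by auto
    then have "overlap_weight p s x y \<le> weight_bound y"
      using L by (intro overlap_weight_le_weight_bound) simp
    also have "\<dots> \<le> weight_bound L"
      using \<open>L \<le> y\<close> L by (intro weight_bound_antimono) auto
    finally show "overlap_weight p s x y \<le> weight_bound L" .
  qed
  also have "\<dots> = (real (card Z))\<^sup>2 * weight_bound L"
    by (simp add: power2_eq_square)
  finally show ?thesis
    using janson_inequality[of "{1..N}" "sum_sets s Z" p] sum_subset_prob_sum_sets[OF Z_le] fin
    by (auto simp: finite_sum_sets intro: order.trans)
qed

lemma subset_prob_avoids_disjoint_le:
  assumes Y: "Y \<subseteq> {L..N}" "real (card Y) \<le> k" and Z: "Z \<subseteq> {L..N}" "real (card Z) \<le> k"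
    and disj: "Y \<inter> Z = {}" and L: "4 \<le> L" "weight_bound L \<le> 1 / 2"
  defines "\<delta> \<equiv> weight_bound L"
  shows "subset_prob {1..N} p (\<lambda>A. avoids (sum_sets s Y) A \<and> avoids (sum_sets s Z) A) \<le>
    exp (2 * k\<^sup>2 * \<delta> + 4 * k * \<delta>) *
    (subset_prob {1..N} p (avoids (sum_sets s Y)) * subset_prob {1..N} p (avoids (sum_sets s Z)))"
proof -
  have "0 \<le> \<delta>" by (simp add: \<delta>_def weight_bound_nonneg)
  have "finite Y" "finite Z" using Y(1) Z(1) finite_subset by blast+
  have card: "real (card (Y \<union> Z)) \<le> 2 * k"
    using card_Un_le[of Y Z] Y(2) Z(2) by linarith
  have reps: "expected_reps (Y \<union> Z) = expected_reps Y + expected_reps Z"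
    unfolding expected_reps_def using \<open>finite Y\<close> \<open>finite Z\<close> disj by (rule sum.union_disjoint)
  have "subset_prob {1..N} p (\<lambda>A. avoids (sum_sets s Y) A \<and> avoids (sum_sets s Z) A) =
      subset_prob {1..N} p (avoids (sum_sets s (Y \<union> Z)))"
    by (simp add: sum_sets_Un avoids_Un[abs_def])
  also have "\<dots> \<le> exp (- expected_reps (Y \<union> Z) + (real (card (Y \<union> Z)))\<^sup>2 * \<delta> / 2)"
    unfolding \<delta>_def using Y Z L(1) by (intro subset_prob_avoids_sum_sets_le) auto
  also have "\<dots> \<le> exp ((2 * k\<^sup>2 * \<delta> + 4 * k * \<delta>) +
      (- (1 + 2 * \<delta>) * expected_reps Y + - (1 + 2 * \<delta>) * expected_reps Z))"
  proof -
    have "(real (card (Y \<union> Z)))\<^sup>2 * \<delta> \<le> (2 * k)\<^sup>2 * \<delta>"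
      using card \<open>0 \<le> \<delta>\<close> by (intro mult_right_mono power_mono) auto
    moreover have "2 * \<delta> * (expected_reps Y + expected_reps Z) \<le> 2 * \<delta> * (k + k)"
      using expected_reps_le_card[of Y] expected_reps_le_card[of Z] Y(2) Z(2) \<open>0 \<le> \<delta>\<close>
      by (intro mult_left_mono add_mono) auto
    ultimately show ?thesis by (simp add: reps algebra_simps)
  qed
  also have "\<dots> = exp (2 * k\<^sup>2 * \<delta> + 4 * k * \<delta>) *
      (exp (- (1 + 2 * \<delta>) * expected_reps Y) * exp (- (1 + 2 * \<delta>) * expected_reps Z))"
    by (simp only: exp_add)
  also have "\<dots> \<le> exp (2 * k\<^sup>2 * \<delta> + 4 * k * \<delta>) *
      (subset_prob {1..N} p (avoids (sum_sets s Y)) * subset_prob {1..N} p (avoids (sum_sets s Z)))"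
    unfolding \<delta>_def using Y(1) Z(1) L
    by (intro mult_left_mono mult_mono exp_le_subset_prob_avoids_sum_sets) auto
  finally show ?thesis .
qed

end

section \<open>Shifts of the deterministic sequence\<close>

definition shifts :: "nat set \<Rightarrow> nat \<Rightarrow> nat set" where
  "shifts B n = (\<lambda>b. n - b) ` {b\<in>B. b \<le> n}"

lemma card_shifts: "card (shifts B n) = counting_fun B n"
  unfolding shifts_def counting_fun_def by (intro card_image) (auto simp: inj_on_def)

lemma counting_fun_mono: "m \<le> n \<Longrightarrow> counting_fun B m \<le> counting_fun B n"
  unfolding counting_fun_def by (intro card_mono) auto

lemma shifts_subset_interval: "shifts B n \<subseteq> {L..} \<Longrightarrow> n \<le> N \<Longrightarrow> shifts B n \<subseteq> {L..N}"
  by (force simp: shifts_def)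

lemma card_shifts_le: "n \<le> N \<Longrightarrow> card (shifts B n) \<le> counting_fun B N"
  by (simp add: card_shifts counting_fun_mono)

lemma avoids_sum_sets_shifts_iff:
  assumes "0 \<notin> A"
  shows "avoids (sum_sets s (shifts B n)) A \<longleftrightarrow> \<not> representable s A B n"
proof -
  have "(\<exists>S\<in>sum_sets s (shifts B n). S \<subseteq> A) \<longleftrightarrow> representable s A B n"
  proof
    assume "\<exists>S\<in>sum_sets s (shifts B n). S \<subseteq> A"
    then obtain S b where S: "S \<subseteq> A" "S \<in> summand_sets s (n - b)" "b \<in> B" "b \<le> n"
      by (auto simp: sum_sets_def shifts_def)
    then have "finite S" "card S = s" "\<Sum>S = n - b" by (auto simp: summand_sets_def)
    then obtain a where a: "bij_betw a {1..s} S" using ex_bij_betw_nat_finite_1 by blast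
    then have "(\<Sum>i=1..s. a i) = \<Sum>S" by (rule sum.reindex_bij_betw)
    then show "representable s A B n"
      unfolding representable_def using a S \<open>\<Sum>S = n - b\<close>
      by (intro exI[of _ a] exI[of _ b]) (auto simp: bij_betw_def)
  next
    assume "representable s A B n"
    then obtain a b where a: "\<forall>i\<in>{1..s}. a i \<in> A" "inj_on a {1..s}"
      and "b \<in> B" "n = (\<Sum>i=1..s. a i) + b"
      by (auto simp: representable_def)
    have "a ` {1..s} \<in> summand_sets s (n - b)"
      using a \<open>n = _\<close> assms by (auto simp: summand_sets_def card_image sum.reindex)
    then show "\<exists>S\<in>sum_sets s (shifts B n). S \<subseteq> A"
      using a(1) \<open>b \<in> B\<close> \<open>n = _\<close>
      by (intro bexI[of _ "a ` {1..s}"]) (auto simp: sum_sets_def shifts_def)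
  qed
  then show ?thesis unfolding avoids_def by blast
qed

lemma card_intersecting_shifts_le:
  assumes "n \<le> N" "G \<subseteq> {..N}"
  shows "card {m\<in>G. shifts B n \<inter> shifts B m \<noteq> {}} \<le> counting_fun B N ^ 2"
proof -
  define B' where "B' = {b\<in>B. b \<le> N}"
  have "{m\<in>G. shifts B n \<inter> shifts B m \<noteq> {}} \<subseteq> (\<lambda>(b, b'). n - b + b') ` (B' \<times> B')"
  proof
    fix m assume "m \<in> {m\<in>G. shifts B n \<inter> shifts B m \<noteq> {}}"
    then obtain b b' where b: "b \<in> B" "b \<le> n" "b' \<in> B" "b' \<le> m" "n - b = m - b'" "m \<in> G"
      by (auto simp: shifts_def)
    then have "b \<in> B'" "b' \<in> B'" "m = n - b + b'" using assms by (auto simp: B'_def)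
    then show "m \<in> (\<lambda>(b, b'). n - b + b') ` (B' \<times> B')" by force
  qed
  then have "card {m\<in>G. shifts B n \<inter> shifts B m \<noteq> {}} \<le> card (B' \<times> B')"
    by (rule surj_card_le[rotated]) (simp add: B'_def)
  then show ?thesis
    by (simp add: card_cartesian_product B'_def counting_fun_def power2_eq_square)
qed

lemma card_large_shifts_ge:
  "N - N0 \<le> card {n\<in>{N0<..N}. shifts B n \<subseteq> {L..}} + counting_fun B N * L"
proof -
  define B' where "B' = {b\<in>B. b \<le> N}"
  let ?G = "{n\<in>{N0<..N}. shifts B n \<subseteq> {L..}}" and ?I = "\<Union>b\<in>B'. {b..<b + L}"
  have "finite B'" by (simp add: B'_def)
  have "{N0<..N} \<subseteq> ?G \<union> ?I"
  proof
    fix n assume n: "n \<in> {N0<..N}"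
    show "n \<in> ?G \<union> ?I"
    proof (cases "n \<in> ?G")
      case False
      then obtain b where "b \<in> B" "b \<le> n" "n - b < L"
        using n by (force simp: shifts_def not_le)
      then have "b \<in> B'" "n \<in> {b..<b + L}" using n by (auto simp: B'_def)
      then show ?thesis by blast
    qed simp
  qed
  then have "card {N0<..N} \<le> card ?G + card ?I"
    using \<open>finite B'\<close> by (intro order.trans[OF card_mono card_Un_le]) auto
  also have "card ?I \<le> (\<Sum>b\<in>B'. card {b..<b + L})"
    using \<open>finite B'\<close> by (rule card_UN_le)
  also have "\<dots> = counting_fun B N * L"
    by (simp add: B'_def counting_fun_def)
  finally show ?thesis by simp
qed

section \<open>Intervals in which every integer is representable\<close>

context pseudo_power
begin

lemma subset_prob_not_representable:
  "subset_prob {1..N} p (\<lambda>A. \<not> representable s A B n) =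
    subset_prob {1..N} p (avoids (sum_sets s (shifts B n)))"
proof (rule subset_prob_cong)
  fix A assume "A \<subseteq> {1..N}"
  then have "0 \<notin> A" by auto
  then show "\<not> representable s A B n \<longleftrightarrow> avoids (sum_sets s (shifts B n)) A"
    by (simp add: avoids_sum_sets_shifts_iff)
qed simp

lemma subset_prob_not_representable_ge:
  assumes n: "n \<le> N" "shifts B n \<subseteq> {L..}" and B: "real (counting_fun B N) \<le> k"
    and L: "4 \<le> L" "weight_bound L \<le> 1 / 2"
  shows "exp (- (1 + 2 * weight_bound L) * (lambda_const s * k)) \<le>
    subset_prob {1..N} p (\<lambda>A. \<not> representable s A B n)"
proof -
  have "expected_reps (shifts B n) \<le> lambda_const s * real (card (shifts B n))"
    by (rule expected_reps_le)
  also have "\<dots> \<le> lambda_const s * k"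
    using card_shifts_le[OF n(1), of B] B lambda_const_pos by (intro mult_left_mono) auto
  finally have "exp (- (1 + 2 * weight_bound L) * (lambda_const s * k)) \<le>
      exp (- (1 + 2 * weight_bound L) * expected_reps (shifts B n))"
    using weight_bound_nonneg[of L] by (simp add: mult_left_mono)
  also have "\<dots> \<le> subset_prob {1..N} p (avoids (sum_sets s (shifts B n)))"
    using shifts_subset_interval[OF n(2,1)] L by (rule exp_le_subset_prob_avoids_sum_sets)
  finally show ?thesis by (simp only: subset_prob_not_representable)
qed

lemma subset_prob_not_representable_both_le:
  assumes n: "n \<le> N" "shifts B n \<subseteq> {L..}" and m: "m \<le> N" "shifts B m \<subseteq> {L..}"
    and disj: "shifts B n \<inter> shifts B m = {}" and B: "real (counting_fun B N) \<le> k"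
    and L: "4 \<le> L" "weight_bound L \<le> 1 / 2"
  shows "subset_prob {1..N} p (\<lambda>A. \<not> representable s A B n \<and> \<not> representable s A B m) \<le>
    exp (2 * k\<^sup>2 * weight_bound L + 4 * k * weight_bound L) *
    (subset_prob {1..N} p (\<lambda>A. \<not> representable s A B n) *
      subset_prob {1..N} p (\<lambda>A. \<not> representable s A B m))"
proof -
  have card: "real (card (shifts B i)) \<le> k" if "i \<le> N" for i
    using card_shifts_le[OF that, of B] B by linarith
  have "subset_prob {1..N} p (\<lambda>A. \<not> representable s A B n \<and> \<not> representable s A B m) =
      subset_prob {1..N} p
        (\<lambda>A. avoids (sum_sets s (shifts B n)) A \<and> avoids (sum_sets s (shifts B m)) A)"
  proof (rule subset_prob_cong)
    fix A assume "A \<subseteq> {1..N}"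
    then have "0 \<notin> A" by auto
    then show "\<not> representable s A B n \<and> \<not> representable s A B m \<longleftrightarrow>
        avoids (sum_sets s (shifts B n)) A \<and> avoids (sum_sets s (shifts B m)) A"
      by (simp add: avoids_sum_sets_shifts_iff)
  qed simp
  then show ?thesis
    using subset_prob_avoids_disjoint_le[OF shifts_subset_interval[OF n(2,1)] card[OF n(1)]
        shifts_subset_interval[OF m(2,1)] card[OF m(1)] disj L]
    by (simp only: subset_prob_not_representable)
qed

lemma sum_subset_prob_not_representable_ge:
  assumes B: "real (counting_fun B N) \<le> k" and L: "4 \<le> L" "weight_bound L \<le> 1 / 2"
  shows "(real N - real N0 - k * real L) * exp (- (1 + 2 * weight_bound L) * (lambda_const s * k)) \<le>
    (\<Sum>n\<in>{n\<in>{N0<..N}. shifts B n \<subseteq> {L..}}. subset_prob {1..N} p (\<lambda>A. \<not> representable s A B n))"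
proof -
  let ?G = "{n\<in>{N0<..N}. shifts B n \<subseteq> {L..}}"
  let ?q = "exp (- (1 + 2 * weight_bound L) * (lambda_const s * k))"
  have "real N - real N0 \<le> real (card ?G + counting_fun B N * L)"
    using of_nat_mono[OF card_large_shifts_ge[of N N0 B L], where 'a = real] by simp
  also have "\<dots> \<le> real (card ?G) + k * real L"
    using B by (simp add: mult_right_mono)
  finally have "(real N - real N0 - k * real L) * ?q \<le> real (card ?G) * ?q"
    by (intro mult_right_mono) auto
  also have "\<dots> \<le> (\<Sum>n\<in>?G. subset_prob {1..N} p (\<lambda>A. \<not> representable s A B n))"
    using B L by (intro sum_bounded_below subset_prob_not_representable_ge) auto
  finally show ?thesis .
qed

lemma subset_prob_all_representable_le:
  fixes N N0 L :: nat and k :: real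
  defines "\<delta> \<equiv> weight_bound L"
  defines "Q \<equiv> (real N - real N0 - k * real L) * exp (- (1 + 2 * \<delta>) * (lambda_const s * k))"
  assumes B: "real (counting_fun B N) \<le> k" and L: "4 \<le> L" "\<delta> \<le> 1 / 2"
    and N: "0 < real N - real N0 - k * real L"
  shows "subset_prob {1..N} p (\<lambda>A. \<forall>n\<in>{N0<..N}. representable s A B n) \<le>
    k\<^sup>2 / Q + (exp (2 * k\<^sup>2 * \<delta> + 4 * k * \<delta>) - 1)"
proof -
  define G where "G = {n\<in>{N0<..N}. shifts B n \<subseteq> {L..}}"
  define F where "F n = {A. \<not> representable s A B n}" for n
  define \<epsilon> where "\<epsilon> = exp (2 * k\<^sup>2 * \<delta> + 4 * k * \<delta>) - 1"
  let ?P = "measure_pmf.prob (random_subset {1..N} p)"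
  have "0 \<le> k" using B by (rule order.trans[rotated]) simp
  have "0 < Q" using N by (simp add: Q_def)
  have Q_le: "Q \<le> (\<Sum>n\<in>G. ?P (F n))"
    unfolding Q_def G_def F_def \<delta>_def using B L(1) L(2)[unfolded \<delta>_def]
    by (rule sum_subset_prob_not_representable_ge)
  have pair: "?P (F n \<inter> F m) \<le> (1 + \<epsilon>) * (?P (F n) * ?P (F m))"
    if "n \<in> G" "m \<in> G" "\<not> shifts B n \<inter> shifts B m \<noteq> {}" for n m
    using subset_prob_not_representable_both_le[of n N B L m k] that B L
    by (simp add: G_def F_def \<epsilon>_def \<delta>_def flip: Collect_conj_eq)
  have sparse: "real (card {m\<in>G. shifts B n \<inter> shifts B m \<noteq> {}}) \<le> k\<^sup>2" if "n \<in> G" for n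
  proof -
    have "real (card {m\<in>G. shifts B n \<inter> shifts B m \<noteq> {}}) \<le> real (counting_fun B N ^ 2)"
      using that by (intro of_nat_mono card_intersecting_shifts_le) (auto simp: G_def)
    also have "\<dots> \<le> k\<^sup>2" using B by (simp add: power_mono)
    finally show ?thesis .
  qed
  have "subset_prob {1..N} p (\<lambda>A. \<forall>n\<in>{N0<..N}. representable s A B n) \<le>
      ?P (UNIV - (\<Union>n\<in>G. F n))"
    by (intro measure_pmf.finite_measure_mono) (auto simp: G_def F_def)
  also have "\<dots> \<le> k\<^sup>2 / (\<Sum>n\<in>G. ?P (F n)) + \<epsilon>"
    using Q_le \<open>0 < Q\<close> \<open>0 \<le> k\<close>
    by (intro measure_pmf.prob_no_event_le_sparse_dependence[
          unfolded space_measure_pmf, OF _ _ pair sparse])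
      (auto simp: G_def \<epsilon>_def \<delta>_def weight_bound_nonneg)
  also have "k\<^sup>2 / (\<Sum>n\<in>G. ?P (F n)) \<le> k\<^sup>2 / Q"
    using Q_le \<open>0 < Q\<close> by (intro divide_left_mono mult_pos_pos) auto
  finally show ?thesis by (simp add: \<epsilon>_def)
qed

text \<open>
  For \<open>L\<close> of order \<open>sqrt N\<close> and \<open>k\<close> of order \<open>ln N\<close>, \<open>k * L\<close> is negligible against \<open>N\<close>, and so is
  \<open>weight_bound L\<close> against \<open>k powr (- 2)\<close>.
\<close>

lemma all_representable_bound_tendsto_0:
  fixes c :: real and N0 :: nat
  assumes "0 < c" "c * lambda_const s < 1"
  defines "L \<equiv> \<lambda>N. nat \<lceil>sqrt (real N)\<rceil>"
  defines "k \<equiv> \<lambda>N. c * ln (real N)" and "\<delta> \<equiv> \<lambda>N. weight_bound (L N)"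
  shows "(\<lambda>N. (k N)\<^sup>2 / ((real N - real N0 - k N * real (L N)) *
      exp (- (1 + 2 * \<delta> N) * (lambda_const s * k N))) +
    (exp (2 * (k N)\<^sup>2 * \<delta> N + 4 * k N * \<delta> N) - 1)) \<longlonglongrightarrow> 0"
proof -
  define \<kappa> d \<mu> where "\<kappa> = \<alpha>\<^sup>2 / 2" and "d = 3 * real s ^ 2" and "\<mu> = c * lambda_const s"
  have pos: "0 < \<kappa>" "0 < d" "0 < \<mu>" "\<mu> < 1"
    using s_ge_2 assms(1,2) lambda_const_pos by (auto simp: \<kappa>_def d_def \<mu>_def)
  have \<delta>_eq: "\<delta> = (\<lambda>N. d * real (L N) powr - \<kappa>)"
    by (simp add: \<delta>_def weight_bound_def d_def \<kappa>_def)
  have mean_eq: "lambda_const s * k N = \<mu> * ln (real N)" for N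
    by (simp add: k_def \<mu>_def)
  show ?thesis
    unfolding \<delta>_eq mean_eq unfolding L_def k_def using assms(1) pos by real_asymp
qed

lemma frequently_subset_prob_all_representable_less:
  assumes "0 < c" "c * lambda_const s < 1"
    and B: "\<exists>\<^sub>F N in sequentially. real (counting_fun B N) \<le> c * ln (real N)"
    and "0 < e"
  shows "\<exists>\<^sub>F N in sequentially.
    subset_prob {1..N} p (\<lambda>A. \<forall>n\<in>{N0<..N}. representable s A B n) < e"
proof -
  define L k \<delta> where "L N = nat \<lceil>sqrt (real N)\<rceil>" and "k N = c * ln (real N)"
    and "\<delta> N = weight_bound (L N)" for N
  have "\<forall>\<^sub>F N in sequentially. (k N)\<^sup>2 / ((real N - real N0 - k N * real (L N)) *
      exp (- (1 + 2 * \<delta> N) * (lambda_const s * k N))) +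
    (exp (2 * (k N)\<^sup>2 * \<delta> N + 4 * k N * \<delta> N) - 1) < e"
    using all_representable_bound_tendsto_0[OF assms(1,2)] \<open>0 < e\<close>
    unfolding L_def k_def \<delta>_def by (rule order_tendstoD)
  moreover have "\<forall>\<^sub>F N in sequentially. 4 \<le> L N"
    unfolding L_def by real_asymp
  moreover have "\<forall>\<^sub>F N in sequentially. \<delta> N \<le> 1 / 2"
  proof -
    have "0 < \<alpha>\<^sup>2 / 2" using \<alpha>_pos by simp
    then show ?thesis unfolding \<delta>_def L_def weight_bound_def by real_asymp
  qed
  moreover have "\<forall>\<^sub>F N in sequentially. 0 < real N - real N0 - k N * real (L N)"
    unfolding L_def k_def using assms(1) by real_asymp
  ultimately have "\<forall>\<^sub>F N in sequentially. real (counting_fun B N) \<le> k N \<longrightarrow>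
      subset_prob {1..N} p (\<lambda>A. \<forall>n\<in>{N0<..N}. representable s A B n) < e"
  proof eventually_elim
    case (elim N)
    then show ?case
      using subset_prob_all_representable_le[of B N "k N" "L N" N0] by (auto simp: \<delta>_def)
  qed
  then show ?thesis
    using B unfolding k_def by (rule frequently_mp)
qed

end

section \<open>Transfer to the probability space\<close>

lemma (in prob_space) prob_random_subset_eq:
  fixes \<xi> :: "'i \<Rightarrow> 'a \<Rightarrow> bool"
  assumes fin: "finite I" and indep: "indep_vars (\<lambda>_. count_space UNIV) \<xi> I"
    and distr: "\<And>i. i \<in> I \<Longrightarrow> distr M (count_space UNIV) (\<xi> i) = measure_pmf (bernoulli_pmf (p i))"
    and S: "S \<subseteq> I"
  shows "{\<omega>\<in>space M. {i\<in>I. \<xi> i \<omega>} = S} \<in> events"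
    and "prob {\<omega>\<in>space M. {i\<in>I. \<xi> i \<omega>} = S} = pmf (random_subset I p) S"
proof -
  have meas: "\<xi> i \<in> measurable M (count_space UNIV)" if "i \<in> I" for i
    using indep that by (auto simp: indep_vars_def)
  have prob_vimage: "prob (\<xi> i -` {b} \<inter> space M) = pmf (bernoulli_pmf (p i)) b" if "i \<in> I" for i b
    using measure_distr[OF meas[OF that], of "{b}"] distr[OF that]
    by (simp add: measure_pmf_single)
  have "{\<omega>\<in>space M. {i\<in>I. \<xi> i \<omega>} = S} \<in> events \<and>
      prob {\<omega>\<in>space M. {i\<in>I. \<xi> i \<omega>} = S} = (\<Prod>i\<in>I. pmf (bernoulli_pmf (p i)) (i \<in> S))"
  proof (cases "I = {}")
    case True
    then show ?thesis using S by (simp add: prob_space)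
  next
    case False
    have "{\<omega>\<in>space M. {i\<in>I. \<xi> i \<omega>} = S} = (\<Inter>i\<in>I. \<xi> i -` {i \<in> S} \<inter> space M)"
      using S False by auto
    moreover have "(\<Inter>i\<in>I. \<xi> i -` {i \<in> S} \<inter> space M) \<in> events"
      using fin False meas by (intro sets.finite_INT measurable_sets) auto
    moreover have "prob (\<Inter>i\<in>I. \<xi> i -` {i \<in> S} \<inter> space M) =
        (\<Prod>i\<in>I. pmf (bernoulli_pmf (p i)) (i \<in> S))"
      using fin False by (subst indep_varsD[OF indep]) (auto simp: prob_vimage)
    ultimately show ?thesis by simp
  qed
  then show "{\<omega>\<in>space M. {i\<in>I. \<xi> i \<omega>} = S} \<in> events"
    and "prob {\<omega>\<in>space M. {i\<in>I. \<xi> i \<omega>} = S} = pmf (random_subset I p) S"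
    by (simp_all add: pmf_random_subset fin S)
qed

lemma (in prob_space) prob_random_subset:
  fixes \<xi> :: "'i \<Rightarrow> 'a \<Rightarrow> bool"
  assumes "finite I" "indep_vars (\<lambda>_. count_space UNIV) \<xi> I"
    "\<And>i. i \<in> I \<Longrightarrow> distr M (count_space UNIV) (\<xi> i) = measure_pmf (bernoulli_pmf (p i))"
  shows "{\<omega>\<in>space M. P {i\<in>I. \<xi> i \<omega>}} \<in> events"
    and "prob {\<omega>\<in>space M. P {i\<in>I. \<xi> i \<omega>}} = subset_prob I p P"
proof -
  define E where "E S = {\<omega>\<in>space M. {i\<in>I. \<xi> i \<omega>} = S}" for S
  let ?\<S> = "{S\<in>Pow I. P S}"
  have E: "E S \<in> events" "prob (E S) = pmf (random_subset I p) S" if "S \<in> ?\<S>" for S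
    using prob_random_subset_eq[OF assms, of S] that by (auto simp: E_def)
  have union_E: "{\<omega>\<in>space M. P {i\<in>I. \<xi> i \<omega>}} = (\<Union>S\<in>?\<S>. E S)"
    by (auto simp: E_def)
  show "{\<omega>\<in>space M. P {i\<in>I. \<xi> i \<omega>}} \<in> events"
    unfolding union_E using E(1) assms(1) by (intro sets.finite_UN) auto
  have "prob {\<omega>\<in>space M. P {i\<in>I. \<xi> i \<omega>}} = (\<Sum>S\<in>?\<S>. prob (E S))"
    unfolding union_E using E(1) assms(1)
    by (intro finite_measure_finite_Union) (auto simp: disjoint_family_on_def E_def)
  also have "\<dots> = measure_pmf.prob (random_subset I p) ?\<S>"
    using E(2) assms(1) by (simp add: measure_measure_pmf_finite)
  also have "\<dots> = subset_prob I p (\<lambda>S. S \<in> ?\<S>)" by simp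
  also have "\<dots> = subset_prob I p P"
    using assms(1) by (rule subset_prob_cong) auto
  finally show "prob {\<omega>\<in>space M. P {i\<in>I. \<xi> i \<omega>}} = subset_prob I p P" .
qed

lemma (in prob_space) prob_pseudo_powers_Int:
  assumes "pseudo_power_vars s \<xi>"
  shows "{\<omega>\<in>space M. P (pseudo_powers \<xi> \<omega> \<inter> {1..N})} \<in> events"
    and "prob {\<omega>\<in>space M. P (pseudo_powers \<xi> \<omega> \<inter> {1..N})} = subset_prob {1..N} (pseudo_prob s) P"
proof -
  have "indep_vars (\<lambda>_. count_space UNIV) \<xi> {1..N}"
    using assms by (auto simp: pseudo_power_vars_def intro: indep_vars_subset)
  moreover have "distr M (count_space UNIV) (\<xi> i) = measure_pmf (bernoulli_pmf (pseudo_prob s i))"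
    if "i \<in> {1..N}" for i
    using assms that by (simp add: pseudo_power_vars_def pseudo_prob_def)
  moreover have "pseudo_powers \<xi> \<omega> \<inter> {1..N} = {i\<in>{1..N}. \<xi> i \<omega>}" for \<omega>
    by (auto simp: pseudo_powers_def)
  ultimately show "{\<omega>\<in>space M. P (pseudo_powers \<xi> \<omega> \<inter> {1..N})} \<in> events"
    and "prob {\<omega>\<in>space M. P (pseudo_powers \<xi> \<omega> \<inter> {1..N})} = subset_prob {1..N} (pseudo_prob s) P"
    using prob_random_subset[of "{1..N}" \<xi> "pseudo_prob s" P] by simp_all
qed

lemma representable_Int_iff:
  assumes "n \<le> N" "0 \<notin> A"
  shows "representable s (A \<inter> {1..N}) B n \<longleftrightarrow> representable s A B n"
proof
  assume "representable s A B n"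
  then obtain a b where a: "\<forall>i\<in>{1..s}. a i \<in> A" "inj_on a {1..s}" "b \<in> B" "n = (\<Sum>i=1..s. a i) + b"
    by (auto simp: representable_def)
  have "a i \<in> A \<inter> {1..N}" if "i \<in> {1..s}" for i
  proof -
    have "a i \<le> (\<Sum>i=1..s. a i)" using that by (intro member_le_sum) auto
    moreover have "a i \<noteq> 0" using a(1) that assms(2) by metis
    ultimately show ?thesis using a that assms(1) by auto
  qed
  then show "representable s (A \<inter> {1..N}) B n" unfolding representable_def using a by blast
next
  assume "representable s (A \<inter> {1..N}) B n"
  then show "representable s A B n" unfolding representable_def by blast
qed

lemma (in prob_space) AE_ex_not_representable:
  assumes vars: "pseudo_power_vars s \<xi>"
    and small: "\<And>e. 0 < e \<Longrightarrow>
      \<exists>N. subset_prob {1..N} (pseudo_prob s) (\<lambda>A. \<forall>n\<in>{N0<..N}. representable s A B n) < e"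
  shows "AE \<omega> in M. \<exists>n>N0. \<not> representable s (pseudo_powers \<xi> \<omega>) B n"
proof -
  have Int_iff: "representable s (pseudo_powers \<xi> \<omega> \<inter> {1..N}) B n \<longleftrightarrow>
      representable s (pseudo_powers \<xi> \<omega>) B n"
    if "n \<le> N" for n N \<omega>
    using that by (intro representable_Int_iff) (auto simp: pseudo_powers_def)
  define H where "H = {\<omega>\<in>space M. \<forall>n\<in>{N0<..}. representable s (pseudo_powers \<xi> \<omega>) B n}"
  have "{\<omega>\<in>space M. representable s (pseudo_powers \<xi> \<omega>) B n} \<in> events" for n
    using prob_pseudo_powers_Int(1)[OF vars, of "\<lambda>A. representable s A B n" n]
    by (simp only: Int_iff[OF order_refl])
  then have "H \<in> events"
    unfolding H_def by (intro sets.sets_Collect_countable_Ball) auto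
  have "prob H \<le> 0 + e" if e: "0 < e" for e
  proof -
    obtain N where
      N: "subset_prob {1..N} (pseudo_prob s) (\<lambda>A. \<forall>n\<in>{N0<..N}. representable s A B n) < e"
      using small[OF e] by blast
    have "H \<subseteq> {\<omega>\<in>space M. \<forall>n\<in>{N0<..N}. representable s (pseudo_powers \<xi> \<omega> \<inter> {1..N}) B n}"
      by (auto simp: H_def Int_iff simp del: One_nat_def)
    then have "prob H \<le>
        prob {\<omega>\<in>space M. \<forall>n\<in>{N0<..N}. representable s (pseudo_powers \<xi> \<omega> \<inter> {1..N}) B n}"
      by (intro finite_measure_mono prob_pseudo_powers_Int(1)[OF vars])
    also have "\<dots> = subset_prob {1..N} (pseudo_prob s) (\<lambda>A. \<forall>n\<in>{N0<..N}. representable s A B n)"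
      using vars by (rule prob_pseudo_powers_Int(2))
    also have "\<dots> < e" by (rule N)
    finally show ?thesis by simp
  qed
  then have "prob H \<le> 0" by (rule field_le_epsilon)
  then have "AE \<omega> in M. \<omega> \<notin> H" using \<open>H \<in> events\<close> by (simp add: prob_eq_0 measure_le_0_iff)
  then show ?thesis using AE_space by eventually_elim (auto simp: H_def)
qed

lemma frequently_counting_fun_le:
  assumes "liminf (\<lambda>n. ereal (real (counting_fun B n) / ln (real n))) < ereal c"
  shows "\<exists>\<^sub>F N in sequentially. real (counting_fun B N) \<le> c * ln (real N)"
proof (rule ccontr)
  assume "\<not> ?thesis"
  then have "\<forall>\<^sub>F N in sequentially. \<not> real (counting_fun B N) \<le> c * ln (real N)"
    by (simp add: not_frequently)
  then have "\<forall>\<^sub>F N in sequentially. ereal c \<le> ereal (real (counting_fun B N) / ln (real N))"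
    using eventually_ge_at_top[of 2]
    by eventually_elim (simp add: pos_le_divide_eq)
  then show False using Liminf_bounded assms by (metis not_less)
qed

theorem theorem3:
  fixes M :: "'a measure" and \<xi> :: "nat \<Rightarrow> 'a \<Rightarrow> bool"
    and s :: nat and B :: "nat set"
  assumes "prob_space M"
    and "s \<ge> 2"
    and "liminf (\<lambda>n. ereal (real (counting_fun B n) / ln (real n))) < ereal (inverse (lambda_const s))"
    and "prob_space.pseudo_power_vars M s \<xi>"
  shows "AE \<omega> in M. infinite {n. \<not> representable s (pseudo_powers \<xi> \<omega>) B n}"
proof -
  interpret prob_space M by fact
  interpret pseudo_power s by unfold_locales fact
  let ?l = "liminf (\<lambda>n. ereal (real (counting_fun B n) / ln (real n)))"
  have "max 0 ?l < ereal (inverse (lambda_const s))"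
    using assms(3) lambda_const_pos by simp
  then obtain c where "max 0 ?l < ereal c" "ereal c < ereal (inverse (lambda_const s))"
    using ereal_dense2 by blast
  then have c_bounds: "0 < c" "c * lambda_const s < 1"
    and freq: "\<exists>\<^sub>F N in sequentially. real (counting_fun B N) \<le> c * ln (real N)"
    using lambda_const_pos by (auto simp: field_simps intro: frequently_counting_fun_le)
  have "AE \<omega> in M. \<exists>n>N0. \<not> representable s (pseudo_powers \<xi> \<omega>) B n" for N0
    using assms(4) frequently_ex[OF frequently_subset_prob_all_representable_less[OF c_bounds freq]]
    by (rule AE_ex_not_representable)
  then have "AE \<omega> in M. \<forall>N0. \<exists>n>N0. \<not> representable s (pseudo_powers \<xi> \<omega>) B n"
    unfolding AE_all_countable by (intro allI)
  then show ?thesis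
    by (simp add: infinite_nat_iff_unbounded)
qed

end
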